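(* Let $A\in\mathbb{C}^{n\times n}$ be Hermitian, and let $\mathcal{X},\mathcal{Y}\subseteq\mathbb{C}^n$ be subspaces of the same dimension $k$, with orthonormal bases given by the columns of $X,Y\in\mathbb{C}^{n\times k}$ respectively. Assume that one of $\mathcal{X}$, $\mathcal{Y}$ is $A$-invariant (call it the invariant subspace). Assume in addition that at least one of the following holds: (a) the invariant subspace corresponds to a contiguous set of the largest (or of the smallest) eigenvalues of $A$, i.e. it is spanned by eigenvectors of $A$ belonging to $\lambda_1(A),\dots,\lambda_k(A)$ (or to $\lambda_{n-k+1}(A),\dots,\lambda_n(A)$); (b) all eigenvalues of $A$ corresponding to the invariant subspace (i.e. the eigenvalues of the restriction of $A$ to it) lie in the closed interval between one extreme eigenvalue of $A$ ($\lambda_1(A)$ or $\lambda_n(A)$) and the midpoint $(\lambda_1(A)+\lambda_n(A))/2$. Then $$|\lambda(X^HAX)-\lambda(Y^HAY)|\ \prec_w\ \mathrm{spr}(A)\,\sin^2\theta(\mathcal{X},\mathcal{Y}).$$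
   Context: For a Hermitian matrix $M$, $\lambda(M)$ denotes the vector of its eigenvalues arranged in nonincreasing order, $\lambda_i(M)$ its $i$-th entry; for $A\in\mathbb{C}^{n\times n}$ Hermitian, $\mathrm{spr}(A)=\lambda_1(A)-\lambda_n(A)$. For any matrix $B$, $s(B)$ is the vector of singular values in nonincreasing order, and $s^{\uparrow}(B)$ the same in nondecreasing order. For subspaces $\mathcal{X},\mathcal{Y}$ of equal dimension $k$ with orthonormal-column basis matrices $X,Y$, the vector of principal angles $\theta(\mathcal{X},\mathcal{Y})\in[0,\pi/2]^k$ is arranged in nonincreasing order and defined by $\cos\theta(\mathcal{X},\mathcal{Y})=s^{\uparrow}(X^HY)$. Functions such as $\sin^2$, $\cos$, $|\cdot|$ act componentwise on vectors. For $x\in\mathbb{R}^k$, $x^{\downarrow}$ is $x$ rearranged in nonincreasing order; $x\prec_w y$ (weak submajorization) means $\sum_{i=1}^j x_i^{\downarrow}\le\sum_{i=1}^j y_i^{\downarrow}$ for all $1\le j\le k$. *)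

theory Defs
  imports Complex_Main "Jordan_Normal_Form.Schur_Decomposition" "Jordan_Normal_Form.Char_Poly"
begin

definition eigvals :: "complex mat \<Rightarrow> complex list" where
  "eigvals M = (SOME as. char_poly M = (\<Prod>a\<leftarrow>as. [:- a, 1:]) \<and> length as = dim_row M)"

text \<open>lambda(M): eigenvalues of a Hermitian matrix in nonincreasing order (entry i-1 is lambda_i).\<close>
definition eig_desc :: "complex mat \<Rightarrow> real list" where
  "eig_desc M = rev (sort (map Re (eigvals M)))"

definition hermitian_mat :: "complex mat \<Rightarrow> bool" where
  "hermitian_mat M \<longleftrightarrow> square_mat M \<and> mat_adjoint M = M"

definition spr :: "complex mat \<Rightarrow> real" where
  "spr A = eig_desc A ! 0 - eig_desc A ! (dim_row A - 1)"

definition sing_vals :: "complex mat \<Rightarrow> real list" where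
  "sing_vals B = map sqrt (eig_desc (mat_adjoint B * B))"

definition princ_angles :: "complex mat \<Rightarrow> complex mat \<Rightarrow> real list" where
  "princ_angles X Y = map arccos (rev (sing_vals (mat_adjoint X * Y)))"

definition weak_submaj :: "real list \<Rightarrow> real list \<Rightarrow> bool" where
  "weak_submaj x y \<longleftrightarrow> length x = length y \<and>
     (\<forall>j \<le> length x. sum_list (take j (rev (sort x))) \<le> sum_list (take j (rev (sort y))))"

definition orthonormal_cols :: "complex mat \<Rightarrow> bool" where
  "orthonormal_cols X \<longleftrightarrow> mat_adjoint X * X = 1\<^sub>m (dim_col X)"

definition invariant_cols :: "complex mat \<Rightarrow> complex mat \<Rightarrow> bool" where
  "invariant_cols A X \<longleftrightarrow> (\<exists>M \<in> carrier_mat (dim_col X) (dim_col X). A * X = X * M)"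

definition spanned_by_top_eigvecs :: "complex mat \<Rightarrow> complex mat \<Rightarrow> bool" where
  "spanned_by_top_eigvecs A X \<longleftrightarrow>
    (\<exists>V \<in> carrier_mat (dim_row X) (dim_col X). \<exists>Q \<in> carrier_mat (dim_col X) (dim_col X).
       X = V * Q \<and>
       (\<forall>i < dim_col X. A *\<^sub>v col V i = of_real (eig_desc A ! i) \<cdot>\<^sub>v col V i))"

definition spanned_by_bottom_eigvecs :: "complex mat \<Rightarrow> complex mat \<Rightarrow> bool" where
  "spanned_by_bottom_eigvecs A X \<longleftrightarrow>
    (\<exists>V \<in> carrier_mat (dim_row X) (dim_col X). \<exists>Q \<in> carrier_mat (dim_col X) (dim_col X).
       X = V * Q \<and>
       (\<forall>i < dim_col X. A *\<^sub>v col V i =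
          of_real (eig_desc A ! (dim_row A - dim_col X + i)) \<cdot>\<^sub>v col V i))"

text \<open>Condition (b): eigenvalues of the restriction (= eigenvalues of X^H A X) lie between an
  extreme eigenvalue and the midpoint.\<close>
definition restr_eigs_near_top :: "complex mat \<Rightarrow> complex mat \<Rightarrow> bool" where
  "restr_eigs_near_top A X \<longleftrightarrow>
    (\<forall>\<mu> \<in> set (eig_desc (mat_adjoint X * A * X)).
       (eig_desc A ! 0 + eig_desc A ! (dim_row A - 1)) / 2 \<le> \<mu> \<and> \<mu> \<le> eig_desc A ! 0)"

definition restr_eigs_near_bottom :: "complex mat \<Rightarrow> complex mat \<Rightarrow> bool" where
  "restr_eigs_near_bottom A X \<longleftrightarrow>
    (\<forall>\<mu> \<in> set (eig_desc (mat_adjoint X * A * X)).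
       eig_desc A ! (dim_row A - 1) \<le> \<mu> \<and> \<mu> \<le> (eig_desc A ! 0 + eig_desc A ! (dim_row A - 1)) / 2)"

definition extra_condition :: "complex mat \<Rightarrow> complex mat \<Rightarrow> bool" where
  "extra_condition A X \<longleftrightarrow>
     spanned_by_top_eigvecs A X \<or> spanned_by_bottom_eigvecs A X \<or>
     restr_eigs_near_top A X \<or> restr_eigs_near_bottom A X"

end

theory Submission
  imports Defs
begin

text \<open>By symmetry let \<open>X\<close> span the invariant subspace, put \<open>C = X\<^sup>H Y\<close>, \<open>M = X\<^sup>H A X\<close> and
  \<open>W = Y - X C\<close>. Invariance gives \<open>Y\<^sup>H A Y = C\<^sup>H M C + W\<^sup>H A W\<close>, where the eigenvalues of
  \<open>W\<^sup>H W = 1 - C\<^sup>H C\<close> are the squared sines of the principal angles.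

  If \<open>0 \<le> M \<le> m\<close> with square root \<open>R\<close>, then \<open>C\<^sup>H M C\<close> has the eigenvalues of \<open>R C C\<^sup>H R\<close>, which
  differs from \<open>M\<close> by \<open>R (1 - C C\<^sup>H) R\<close>; Lidskii's inequality bounds the eigenvalue differences by
  \<open>m\<close> times the squared sines. If \<open>-m \<le> A \<le> m\<close>, then \<open>W\<^sup>H A W\<close> lies between \<open>\<plusminus> m W\<^sup>H W\<close>, and Lidskii's
  inequality bounds its effect in the same way.

  In case (a), shift \<open>A\<close> to be positive semidefinite with norm \<open>spr A\<close>: by Cauchy interlacing all
  differences have the same sign, the term \<open>W\<^sup>H A W \<ge> 0\<close> only helps, and the first bound suffices.
  In case (b), shift the midpoint of the spectrum to \<open>0\<close>, so that \<open>m = spr A / 2\<close>, and add both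
  bounds. The variants for the bottom of the spectrum follow by replacing \<open>A\<close> with \<open>-A\<close>.

  Every sum of the \<open>j\<close> largest entries is handled by a threshold \<open>t\<close>: the perturbation is dominated by
  \<open>t\<close> plus its positive excess over \<open>t\<close>, and the excess contributes only its trace.\<close>

section \<open>Adjoints and quadratic forms\<close>

lemma mat_adjoint_dim [simp]:
  "dim_row (mat_adjoint M) = dim_col M" "dim_col (mat_adjoint M) = dim_row M"
  by (auto simp: mat_adjoint_def)

lemma mat_adjoint_carrier [simp, intro]:
  "M \<in> carrier_mat n m \<Longrightarrow> mat_adjoint M \<in> carrier_mat m n"
  by (auto simp: mat_adjoint_def mat_of_rows_def)

lemma mat_adjoint_index [simp]:
  fixes M :: "complex mat"
  assumes "i < dim_col M" "j < dim_row M"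
  shows "mat_adjoint M $$ (i, j) = cnj (M $$ (j, i))"
  using assms by (simp add: mat_adjoint_def mat_of_rows_def)

lemma mat_adjoint_adjoint [simp]: "mat_adjoint (mat_adjoint M) = (M :: complex mat)"
  by (rule eq_matI) auto

lemma mat_adjoint_one [simp]: "mat_adjoint (1\<^sub>m n) = (1\<^sub>m n :: complex mat)"
  by (rule eq_matI) auto

lemma mat_adjoint_mult:
  fixes M N :: "complex mat"
  assumes "M \<in> carrier_mat n m" "N \<in> carrier_mat m p"
  shows "mat_adjoint (M * N) = mat_adjoint N * mat_adjoint M"
  by (rule eq_matI) (use assms in \<open>auto simp: scalar_prod_def intro!: sum.cong\<close>)

lemma mat_adjoint_minus:
  fixes M N :: "complex mat"
  assumes "M \<in> carrier_mat n m" "N \<in> carrier_mat n m"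
  shows "mat_adjoint (M - N) = mat_adjoint M - mat_adjoint N"
  by (rule eq_matI) (use assms in auto)

lemma mat_adjoint_add:
  fixes M N :: "complex mat"
  assumes "M \<in> carrier_mat n m" "N \<in> carrier_mat n m"
  shows "mat_adjoint (M + N) = mat_adjoint M + mat_adjoint N"
  by (rule eq_matI) (use assms in auto)

lemma mat_adjoint_smult:
  fixes M :: "complex mat"
  shows "mat_adjoint (c \<cdot>\<^sub>m M) = cnj c \<cdot>\<^sub>m mat_adjoint M"
  by (rule eq_matI) auto

section \<open>Quadratic forms and squared norms\<close>

text \<open>The real part yields an ordered value for every \<open>M\<close>; for Hermitian
  \<open>M\<close> the form is real anyway. All matrix inequalities below are stated through
  \<open>qform\<close>.\<close>

definition qform :: "complex mat \<Rightarrow> complex vec \<Rightarrow> real" where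
  "qform M v = Re ((M *\<^sub>v v) \<bullet>c v)"

definition norm2 :: "complex vec \<Rightarrow> real" where
  "norm2 v = (\<Sum>i<dim_vec v. (cmod (v $ i))\<^sup>2)"

lemma norm2_nonneg: "norm2 v \<ge> 0"
  unfolding norm2_def by (intro sum_nonneg) auto

lemma cscalar_prod_self: "v \<bullet>c v = complex_of_real (norm2 v)"
  by (simp add: norm2_def scalar_prod_def complex_norm_square atLeast0LessThan del: of_real_power)

lemma norm2_pos: "v \<in> carrier_vec n \<Longrightarrow> v \<noteq> 0\<^sub>v n \<Longrightarrow> norm2 v > 0"
  using conjugate_square_eq_0_vec[of v n] norm2_nonneg[of v]
  by (auto simp: cscalar_prod_self less_le)

lemma qform_one [simp]: "v \<in> carrier_vec n \<Longrightarrow> qform (1\<^sub>m n) v = norm2 v"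
  by (simp add: qform_def cscalar_prod_self)

lemma qform_add:
  assumes "M \<in> carrier_mat n n" "N \<in> carrier_mat n n" "v \<in> carrier_vec n"
  shows "qform (M + N) v = qform M v + qform N v"
proof -
  have "(M + N) *\<^sub>v v = M *\<^sub>v v + N *\<^sub>v v"
    using assms by (auto intro: add_mult_distrib_mat_vec)
  moreover have "(M *\<^sub>v v + N *\<^sub>v v) \<bullet>c v = (M *\<^sub>v v) \<bullet>c v + (N *\<^sub>v v) \<bullet>c v"
    using assms by (intro add_scalar_prod_distrib[of _ n]) auto
  ultimately show ?thesis by (simp add: qform_def)
qed

lemma qform_minus:
  assumes "M \<in> carrier_mat n n" "N \<in> carrier_mat n n" "v \<in> carrier_vec n"
  shows "qform (M - N) v = qform M v - qform N v"
proof -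
  have "(M - N) *\<^sub>v v = M *\<^sub>v v - N *\<^sub>v v"
    using assms by (auto intro: minus_mult_distrib_mat_vec)
  moreover have "(M *\<^sub>v v - N *\<^sub>v v) \<bullet>c v = (M *\<^sub>v v) \<bullet>c v - (N *\<^sub>v v) \<bullet>c v"
    using assms by (intro minus_scalar_prod_distrib[of _ n]) auto
  ultimately show ?thesis by (simp add: qform_def)
qed

lemma qform_smult:
  assumes "M \<in> carrier_mat n n" "v \<in> carrier_vec n"
  shows "qform (complex_of_real c \<cdot>\<^sub>m M) v = c * qform M v"
proof -
  have "(complex_of_real c \<cdot>\<^sub>m M) *\<^sub>v v = complex_of_real c \<cdot>\<^sub>v (M *\<^sub>v v)"
    using assms by (intro eq_vecI) auto
  moreover have "(complex_of_real c \<cdot>\<^sub>v (M *\<^sub>v v)) \<bullet>c v = complex_of_real c * ((M *\<^sub>v v) \<bullet>c v)"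
    using assms by (intro smult_scalar_prod_distrib[of _ n]) auto
  ultimately show ?thesis by (simp add: qform_def)
qed

lemma cscalar_prod_adjoint:
  assumes "M \<in> carrier_mat n m" "v \<in> carrier_vec n" "w \<in> carrier_vec m"
  shows "(mat_adjoint M *\<^sub>v v) \<bullet>c w = v \<bullet>c ((M :: complex mat) *\<^sub>v w)"
proof -
  have "(mat_adjoint M *\<^sub>v v) \<bullet>c w = (\<Sum>i<m. \<Sum>j<n. cnj (M $$ (j, i)) * v $ j * cnj (w $ i))"
    using assms by (auto simp: scalar_prod_def atLeast0LessThan sum_distrib_right intro!: sum.cong)
  also have "\<dots> = (\<Sum>j<n. \<Sum>i<m. cnj (M $$ (j, i)) * v $ j * cnj (w $ i))"
    by (rule sum.swap)
  also have "\<dots> = v \<bullet>c (M *\<^sub>v w)"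
    using assms by (auto simp: scalar_prod_def atLeast0LessThan sum_distrib_left intro!: sum.cong)
  finally show ?thesis .
qed

text \<open>The adjoint of \<open>Y\<close> moves across the inner product. This is how statements
  about a compression become statements about the large matrix.\<close>

lemma qform_congruence:
  assumes "Y \<in> carrier_mat n k" "M \<in> carrier_mat n n" "v \<in> carrier_vec k"
  shows "qform (mat_adjoint Y * M * Y) v = qform M (Y *\<^sub>v v)"
proof -
  have "(mat_adjoint Y * M * Y) *\<^sub>v v = mat_adjoint Y *\<^sub>v (M *\<^sub>v (Y *\<^sub>v v))"
    using assms by (simp add: assoc_mult_mat_vec[of _ k n _ k] assoc_mult_mat_vec[of _ k n _ n]
      mult_carrier_mat[of _ _ n])
  then show ?thesis
    using cscalar_prod_adjoint[of Y n k "M *\<^sub>v (Y *\<^sub>v v)" v] assms by (simp add: qform_def)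
qed

lemma norm2_mult_vec:
  assumes "Y \<in> carrier_mat n k" "v \<in> carrier_vec k"
  shows "norm2 (Y *\<^sub>v v) = qform (mat_adjoint Y * Y) v"
  using qform_congruence[OF assms(1) one_carrier_mat assms(2)] assms
  by simp

lemma norm2_isometry:
  assumes "Y \<in> carrier_mat n k" "mat_adjoint Y * Y = 1\<^sub>m k" "v \<in> carrier_vec k"
  shows "norm2 (Y *\<^sub>v v) = norm2 v"
  using assms by (simp add: norm2_mult_vec)

section \<open>Real diagonal matrices\<close>

definition diag_real :: "nat \<Rightarrow> (nat \<Rightarrow> real) \<Rightarrow> complex mat" where
  "diag_real n f = mat n n (\<lambda>(i, j). if i = j then complex_of_real (f i) else 0)"

lemma diag_real_carrier [simp, intro]: "diag_real n f \<in> carrier_mat n n"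
  and diag_real_dim [simp]: "dim_row (diag_real n f) = n" "dim_col (diag_real n f) = n"
  by (auto simp: diag_real_def)

lemma diag_real_index [simp]:
  "i < n \<Longrightarrow> j < n \<Longrightarrow> diag_real n f $$ (i, j) = (if i = j then complex_of_real (f i) else 0)"
  by (auto simp: diag_real_def)

lemma mat_adjoint_diag_real [simp]: "mat_adjoint (diag_real n f) = diag_real n f"
  by (rule eq_matI) auto

lemma diag_real_mult [simp]: "diag_real n f * diag_real n g = diag_real n (\<lambda>i. f i * g i)"
  by (rule eq_matI) (auto simp: scalar_prod_def if_distrib sum.delta' cong: if_cong)

lemma diag_real_mult_vec:
  assumes "v \<in> carrier_vec n"
  shows "diag_real n f *\<^sub>v v = vec n (\<lambda>i. complex_of_real (f i) * v $ i)"
proof (rule eq_vecI; simp)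
  fix i assume i: "i < n"
  have "row (diag_real n f) i \<bullet> v = (\<Sum>j<n. if i = j then complex_of_real (f i) * v $ j else 0)"
    using assms i unfolding scalar_prod_def by (intro sum.cong) auto
  also have "\<dots> = complex_of_real (f i) * v $ i"
    using i by simp
  finally show "row (diag_real n f) i \<bullet> v = complex_of_real (f i) * v $ i" .
qed

lemma qform_diag_real:
  assumes "v \<in> carrier_vec n"
  shows "qform (diag_real n f) v = (\<Sum>i<n. f i * (cmod (v $ i))\<^sup>2)"
proof -
  have "(diag_real n f *\<^sub>v v) \<bullet>c v = (\<Sum>i<n. complex_of_real (f i * (cmod (v $ i))\<^sup>2))"
    using assms
    by (auto simp: diag_real_mult_vec scalar_prod_def atLeast0LessThan complex_norm_square ac_simps
        simp del: of_real_power intro!: sum.cong)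
  then show ?thesis by (simp add: qform_def)
qed

section \<open>Unitary and Hermitian matrices\<close>

definition unitary_mat :: "nat \<Rightarrow> complex mat \<Rightarrow> bool" where
  "unitary_mat n U \<longleftrightarrow> U \<in> carrier_mat n n \<and> mat_adjoint U * U = 1\<^sub>m n \<and> U * mat_adjoint U = 1\<^sub>m n"

text \<open>A left inverse of a square matrix is also a right inverse.\<close>

lemma unitary_matI:
  assumes "U \<in> carrier_mat n n" "mat_adjoint U * U = 1\<^sub>m n"
  shows "unitary_mat n U"
  using assms mat_mult_left_right_inverse[OF mat_adjoint_carrier[OF assms(1)] assms(1)]
  by (simp add: unitary_mat_def)

lemma unitary_matD:
  assumes "unitary_mat n U"
  shows "U \<in> carrier_mat n n" "mat_adjoint U * U = 1\<^sub>m n" "U * mat_adjoint U = 1\<^sub>m n"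
    "mat_adjoint U \<in> carrier_mat n n"
  using assms by (auto simp: unitary_mat_def)

lemma mult_mat_assoc4:
  fixes M :: "complex mat"
  assumes "M \<in> carrier_mat n1 n2" "N \<in> carrier_mat n2 n3" "P \<in> carrier_mat n3 n4"
    "Q \<in> carrier_mat n4 n5"
  shows "M * N * (P * Q) = M * (N * P) * Q"
proof -
  have "M * N * (P * Q) = (M * N * P) * Q"
    using assms by (subst assoc_mult_mat[of _ n1 n3 _ n4 _ n5]) auto
  also have "M * N * P = M * (N * P)"
    using assms by (subst assoc_mult_mat[of _ n1 n2 _ n3 _ n4]) auto
  finally show ?thesis .
qed

lemma unitary_mat_mult:
  assumes "unitary_mat n U" "unitary_mat n V"
  shows "unitary_mat n (U * V)"
proof (rule unitary_matI)
  note U = unitary_matD[OF assms(1)] and V = unitary_matD[OF assms(2)]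
  show "U * V \<in> carrier_mat n n" using U V by auto
  have "mat_adjoint (U * V) * (U * V) = mat_adjoint V * (mat_adjoint U * U) * V"
    using U V by (simp add: mat_adjoint_mult[of _ n n _ n] mult_mat_assoc4[of _ n n _ n _ n _ n])
  then show "mat_adjoint (U * V) * (U * V) = 1\<^sub>m n"
    using U V by (simp add: right_mult_one_mat[of _ n n])
qed

lemma hermitian_matD:
  assumes "hermitian_mat M" "M \<in> carrier_mat n n"
  shows "mat_adjoint M = M" "i < n \<Longrightarrow> j < n \<Longrightarrow> cnj (M $$ (j, i)) = M $$ (i, j)"
proof -
  show eq: "mat_adjoint M = M" using assms by (simp add: hermitian_mat_def)
  show "cnj (M $$ (j, i)) = M $$ (i, j)" if "i < n" "j < n"
    using mat_adjoint_index[of i M j] eq assms(2) that by simp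
qed

lemma gram_carrier: "C \<in> carrier_mat n k \<Longrightarrow> mat_adjoint C * C \<in> carrier_mat k k"
  by (rule mult_carrier_mat[OF mat_adjoint_carrier])

lemma congruence_carrier:
  "M \<in> carrier_mat n n \<Longrightarrow> Y \<in> carrier_mat n k \<Longrightarrow> mat_adjoint Y * M * Y \<in> carrier_mat k k"
  by (rule mult_carrier_mat[OF mult_carrier_mat[OF mat_adjoint_carrier]])

lemma hermitian_congruence:
  assumes "hermitian_mat M" "M \<in> carrier_mat n n" "Y \<in> carrier_mat n k"
  shows "hermitian_mat (mat_adjoint Y * M * Y)"
proof -
  have "mat_adjoint (mat_adjoint Y * M * Y) = mat_adjoint Y * (mat_adjoint M * Y)"
    using assms by (simp add: mat_adjoint_mult[of _ k n _ k] mat_adjoint_mult[of _ k n _ n]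
       mult_carrier_mat[of _ _ n])
  also have "\<dots> = mat_adjoint Y * M * Y"
    using assms hermitian_matD(1)[OF assms(1,2)] by (simp add: assoc_mult_mat[of _ k n _ n _ k])
  finally show ?thesis using assms by (auto simp: hermitian_mat_def)
qed

lemma hermitian_diag_congruence:
  assumes "U \<in> carrier_mat n n"
  shows "hermitian_mat (U * diag_real n f * mat_adjoint U)"
proof -
  have "hermitian_mat (diag_real n f)" by (auto simp: hermitian_mat_def)
  from hermitian_congruence[OF this, of n "mat_adjoint U" n] assms show ?thesis by simp
qed

lemma hermitian_add:
  "hermitian_mat M \<Longrightarrow> hermitian_mat N \<Longrightarrow> M \<in> carrier_mat n n \<Longrightarrow> N \<in> carrier_mat n n \<Longrightarrow>
    hermitian_mat (M + N)"
  by (auto simp: hermitian_mat_def mat_adjoint_add[of _ n n])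

lemma hermitian_minus:
  "hermitian_mat M \<Longrightarrow> hermitian_mat N \<Longrightarrow> M \<in> carrier_mat n n \<Longrightarrow> N \<in> carrier_mat n n \<Longrightarrow>
    hermitian_mat (M - N)"
  by (auto simp: hermitian_mat_def mat_adjoint_minus[of _ n n])

lemma hermitian_smult:
  "hermitian_mat M \<Longrightarrow> hermitian_mat (complex_of_real c \<cdot>\<^sub>m M)"
  by (auto simp: hermitian_mat_def mat_adjoint_smult)

lemma hermitian_one [simp]: "hermitian_mat (1\<^sub>m n)"
  by (auto simp: hermitian_mat_def)

lemma hermitian_gram [simp]: "hermitian_mat (mat_adjoint M * M)"
proof -
  have "mat_adjoint (mat_adjoint M * M) = mat_adjoint M * M"
    by (subst mat_adjoint_mult[of _ "dim_col M" "dim_row M" _ "dim_col M"]) auto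
  then show ?thesis by (auto simp: hermitian_mat_def)
qed

section \<open>Characteristic polynomials and the spectral theorem\<close>

text \<open>Either multiset is the multiset of roots of the product. Hence the list picked by the
  choice operator in \<open>eigvals\<close> is determined up to order.\<close>

lemma mset_eq_if_linear_prod_eq:
  fixes as bs :: "complex list"
  assumes "(\<Prod>a\<leftarrow>as. [:- a, 1:]) = (\<Prod>b\<leftarrow>bs. [:- b, 1:])"
  shows "mset as = mset bs"
proof -
  have "proots (\<Prod>a\<leftarrow>as. [:- a, 1:]) = mset as" for as :: "complex list"
  proof (induction as)
    case (Cons a as)
    have "(\<Prod>a\<leftarrow>as. [:- a, 1:]) \<noteq> 0" by (auto simp: prod_list_zero_iff)
    then show ?case using Cons by (simp add: proots_mult del: mult_pCons_left)
  qed simp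
  then show ?thesis using assms by metis
qed

lemma linear_prod_cong_mset:
  fixes as bs :: "complex list"
  assumes "mset as = mset bs"
  shows "(\<Prod>a\<leftarrow>as. [:- a, 1:]) = (\<Prod>b\<leftarrow>bs. [:- b, 1:])"
proof -
  have "mset (map (\<lambda>a. [:- a, 1:]) as) = mset (map (\<lambda>a. [:- a, 1:]) bs)"
    using assms by simp
  then show ?thesis by (metis prod_mset_prod_list)
qed

text \<open>Over the complex numbers the characteristic polynomial splits, so the choice in
  \<open>eigvals\<close> does select a list of its roots with multiplicity.\<close>

lemma eigvals:
  assumes "M \<in> carrier_mat n n"
  shows "char_poly M = (\<Prod>a\<leftarrow>eigvals M. [:- a, 1:])" "length (eigvals M) = n"
proof -
  have "\<exists>as. char_poly M = (\<Prod>a\<leftarrow>as. [:- a, 1:]) \<and> length as = dim_row M"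
    using char_poly_factorized[OF assms] assms by simp
  from someI_ex[OF this] show "char_poly M = (\<Prod>a\<leftarrow>eigvals M. [:- a, 1:])" "length (eigvals M) = n"
    using assms by (simp_all add: eigvals_def)
qed

lemma length_eig_desc [simp]: "M \<in> carrier_mat n n \<Longrightarrow> length (eig_desc M) = n"
  by (simp add: eig_desc_def eigvals)

lemma eig_desc_antimono:
  assumes "i \<le> j" "j < length (eig_desc M)"
  shows "eig_desc M ! j \<le> eig_desc M ! i"
  using assms sorted_rev_nth_mono[of "eig_desc M" i j] by (simp add: eig_desc_def)

lemma mset_eig_desc_eqI:
  assumes "M \<in> carrier_mat n n" "char_poly M = (\<Prod>x\<leftarrow>xs. [:- complex_of_real x, 1:])"
  shows "mset (eig_desc M) = mset xs"
proof -
  have "(\<Prod>a\<leftarrow>eigvals M. [:- a, 1:]) = (\<Prod>a\<leftarrow>map complex_of_real xs. [:- a, 1:])"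
    using assms eigvals(1)[OF assms(1)] by (simp add: o_def)
  from mset_eq_if_linear_prod_eq[OF this] have "mset (map Re (eigvals M)) = mset xs"
    by (metis (no_types, lifting) Re_complex_of_real map_idI map_map mset_map o_apply)
  then show ?thesis by (simp add: eig_desc_def)
qed

lemma eig_desc_cong:
  assumes "M \<in> carrier_mat n n" "N \<in> carrier_mat n n" "char_poly M = char_poly N"
  shows "eig_desc M = eig_desc N"
proof -
  have "mset (eigvals M) = mset (eigvals N)"
    using mset_eq_if_linear_prod_eq[of "eigvals M" "eigvals N"] assms eigvals(1) by metis
  then have "sort (map Re (eigvals M)) = sort (map Re (eigvals N))"
    by (intro properties_for_sort) auto
  then show ?thesis by (simp add: eig_desc_def)
qed

lemma char_poly_diag_real: "char_poly (diag_real n f) = (\<Prod>x\<leftarrow>map f [0..<n]. [:- complex_of_real x, 1:])"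
proof -
  have "upper_triangular (diag_real n f)" by (auto simp: upper_triangular_def)
  from char_poly_upper_triangular[OF diag_real_carrier this] show ?thesis
    by (simp add: diag_mat_def o_def cong: map_cong)
       (intro arg_cong[where f = prod_list] map_cong, auto)
qed

lemma mset_eig_desc_similar_diag:
  assumes "P \<in> carrier_mat n n" "Q \<in> carrier_mat n n" "P * Q = 1\<^sub>m n"
    and "M = P * diag_real n f * Q"
  shows "mset (eig_desc M) = mset (map f [0..<n])"
proof -
  have "Q * P = 1\<^sub>m n" using mat_mult_left_right_inverse[OF assms(1-3)] .
  moreover have M: "M \<in> carrier_mat n n" using assms by auto
  ultimately have "similar_mat_wit M (diag_real n f) P Q"
    using assms by (intro similar_mat_witI[of _ _ n]) auto
  then have "char_poly M = char_poly (diag_real n f)"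
    using char_poly_similar unfolding similar_mat_def by blast
  then show ?thesis using mset_eig_desc_eqI[OF M] char_poly_diag_real by metis
qed

lemma desc_list_unique:
  fixes xs ys :: "real list"
  assumes "mset xs = mset ys" "sorted (rev xs)" "sorted (rev ys)"
  shows "xs = ys"
  using assms by (metis mset_rev properties_for_sort rev_rev_ident sorted_sort_id)

lemma sorted_rev_eig_desc [simp]: "sorted (rev (eig_desc M))"
  by (simp add: eig_desc_def)

text \<open>The block matrix \<open>?B\<close> has determinant
  \<open>det (x \<cdot>\<^sub>m 1\<^sub>m n - M * N)\<close> because its lower blocks commute.
  Multiplying it by the block triangular \<open>?T\<close> clears the upper right block and exposes
  the other determinant; for nonzero \<open>x\<close> the common factor cancels, and for
  \<open>x = 0\<close> multiplicativity of \<open>det\<close> suffices.\<close>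

lemma det_resolvent_mult_comm:
  fixes M N :: "complex mat"
  assumes M: "M \<in> carrier_mat n n" and N: "N \<in> carrier_mat n n"
  shows "det (x \<cdot>\<^sub>m 1\<^sub>m n - M * N) = det (x \<cdot>\<^sub>m 1\<^sub>m n - N * M)"
proof (cases "x = 0")
  case True
  have "x \<cdot>\<^sub>m 1\<^sub>m n - P = (-1) \<cdot>\<^sub>m P" if "P \<in> carrier_mat n n" for P :: "complex mat"
    using that True by (intro eq_matI) auto
  then show ?thesis using M N by (simp add: det_mult[of _ n] mult.commute)
next
  case False
  let ?I = "1\<^sub>m n :: complex mat"
  let ?B = "four_block_mat (x \<cdot>\<^sub>m ?I) M N ?I"
  let ?T = "four_block_mat ?I (- M) (0\<^sub>m n n) (x \<cdot>\<^sub>m ?I)"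
  have 1: "det ?B = det (x \<cdot>\<^sub>m 1\<^sub>m n - M * N)"
    using M N by (subst det_four_block_mat[of _ n]) auto
  have B: "?B \<in> carrier_mat (n + n) (n + n)" and T: "?T \<in> carrier_mat (n + n) (n + n)"
    using M N by auto
  have eqs: "x \<cdot>\<^sub>m ?I * ?I + M * 0\<^sub>m n n = x \<cdot>\<^sub>m ?I"
    "x \<cdot>\<^sub>m ?I * (- M) + M * (x \<cdot>\<^sub>m ?I) = 0\<^sub>m n n"
    "N * ?I + ?I * 0\<^sub>m n n = N"
    "N * (- M) + ?I * (x \<cdot>\<^sub>m ?I) = x \<cdot>\<^sub>m ?I - N * M"
  proof -
    have a: "x \<cdot>\<^sub>m ?I * (- M) = x \<cdot>\<^sub>m (- M)" using M by (subst mult_smult_assoc_mat[of _ n n _ n]) auto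
    have b: "M * (x \<cdot>\<^sub>m ?I) = x \<cdot>\<^sub>m M" using M by (subst mult_smult_distrib[of _ n n _ n]) auto
    have c: "N * (- M) = - (N * M)" using M N by simp
    show "x \<cdot>\<^sub>m ?I * ?I + M * 0\<^sub>m n n = x \<cdot>\<^sub>m ?I" "N * ?I + ?I * 0\<^sub>m n n = N"
      using M N by auto
    show "x \<cdot>\<^sub>m ?I * (- M) + M * (x \<cdot>\<^sub>m ?I) = 0\<^sub>m n n"
      unfolding a b by (rule eq_matI) (use M in auto)
    show "N * (- M) + ?I * (x \<cdot>\<^sub>m ?I) = x \<cdot>\<^sub>m ?I - N * M"
      unfolding c by (rule eq_matI) (use M N in auto)
  qed
  have "?B * ?T = four_block_mat (x \<cdot>\<^sub>m ?I) (0\<^sub>m n n) N (x \<cdot>\<^sub>m ?I - N * M)"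
    using mult_four_block_mat[of "x \<cdot>\<^sub>m ?I" n n M n N n ?I ?I n "- M" n "0\<^sub>m n n" "x \<cdot>\<^sub>m ?I"] M N
    unfolding eqs by auto
  moreover have "det \<dots> = det (x \<cdot>\<^sub>m ?I) * det (x \<cdot>\<^sub>m ?I - N * M)"
    using M N by (intro det_four_block_mat_upper_right_zero) auto
  moreover have "det ?T = det (x \<cdot>\<^sub>m ?I)"
    using M by (subst det_four_block_mat_lower_left_zero[of _ n _ n]) auto
  ultimately have "det ?B * det (x \<cdot>\<^sub>m ?I) = det (x \<cdot>\<^sub>m ?I) * det (x \<cdot>\<^sub>m ?I - N * M)"
    using det_mult[OF B T] by metis
  moreover have "det (x \<cdot>\<^sub>m ?I) \<noteq> 0" using False by simp
  ultimately show ?thesis using 1 by (metis mult.commute mult_cancel_left)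
qed

text \<open>Complex polynomials that agree at every point are equal, and the value at
  \<open>x\<close> is the determinant of \<open>x \<cdot>\<^sub>m 1\<^sub>m n\<close> minus the
  matrix.\<close>

lemma char_poly_mult_comm:
  fixes M N :: "complex mat"
  assumes M: "M \<in> carrier_mat n n" and N: "N \<in> carrier_mat n n"
  shows "char_poly (M * N) = char_poly (N * M)"
proof -
  have "poly (char_poly P) x = det (x \<cdot>\<^sub>m 1\<^sub>m n - P)" if "P \<in> carrier_mat n n" for P :: "complex mat" and x
  proof -
    have "- char_matrix P x = x \<cdot>\<^sub>m 1\<^sub>m n - P"
      using that by (intro eq_matI) (auto simp: char_matrix_def)
    then show ?thesis using char_poly_matrix[OF that, of x] by simp
  qed
  then have "poly (char_poly (M * N)) = poly (char_poly (N * M))"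
    using M N det_resolvent_mult_comm[OF M N] by (intro ext) simp
  then show ?thesis by (simp add: poly_eq_poly_eq_iff)
qed

lemma eig_desc_mult_comm:
  assumes "M \<in> carrier_mat n n" "N \<in> carrier_mat n n"
  shows "eig_desc (M * N) = eig_desc (N * M)"
  using assms by (intro eig_desc_cong[of _ n] char_poly_mult_comm[of _ n]) auto

section \<open>Unitary diagonalization of Hermitian matrices\<close>

text \<open>Complete \<open>v\<close> to a basis, orthogonalize by Gram-Schmidt and normalize the
  columns. Gram-Schmidt leaves the first vector alone, so only the normalization rescales
  \<open>v\<close>.\<close>

lemma unitary_with_first_col:
  fixes v :: "complex vec"
  assumes v: "v \<in> carrier_vec n" "v \<noteq> 0\<^sub>v n" and n: "n > 0"
  shows "\<exists>W c. unitary_mat n W \<and> col W 0 = c \<cdot>\<^sub>v v"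
proof -
  interpret cof_vec_space n "TYPE(complex)" .
  define ws where "ws = gram_schmidt n (basis_completion v)"
  note bc = basis_completion[OF v]
  from gram_schmidt_result[OF bc(2,4,5) ws_def]
  have ws: "corthogonal ws" "set ws \<subseteq> carrier_vec n" "length ws = n" using bc(6) by auto
  obtain vs where vs: "basis_completion v = v # vs"
    using bc(6,7) n by (cases "basis_completion v") auto
  have "hd ws = v" unfolding ws_def vs using v by simp
  then have ws0: "ws ! 0 = v" using ws(3) n by (simp add: hd_conv_nth[symmetric] flip: length_greater_0_conv)
  have wsc: "ws ! i \<in> carrier_vec n" if "i < n" for i using ws that by auto
  define r where "r i = sqrt (norm2 (ws ! i))" for i
  have r: "r i > 0" "complex_of_real (r i) * complex_of_real (r i) = ws ! i \<bullet>c ws ! i" if "i < n" for i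
  proof -
    have "ws ! i \<bullet>c ws ! i \<noteq> 0" using corthogonalD[OF ws(1), of i i] that ws(3) by auto
    then have "norm2 (ws ! i) > 0" using norm2_nonneg[of "ws ! i"] by (auto simp: cscalar_prod_self less_le)
    then show "r i > 0" "complex_of_real (r i) * complex_of_real (r i) = ws ! i \<bullet>c ws ! i"
      by (auto simp: r_def cscalar_prod_self simp flip: of_real_mult)
  qed
  define W where "W = mat n n (\<lambda>(i, j). ws ! j $ i / complex_of_real (r j))"
  have W: "W \<in> carrier_mat n n" by (auto simp: W_def)
  have "mat_adjoint W * W = 1\<^sub>m n"
  proof (rule eq_matI)
    fix i j assume "i < dim_row (1\<^sub>m n :: complex mat)" "j < dim_col (1\<^sub>m n :: complex mat)"
    then have ij: "i < n" "j < n" by auto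
    have "row (mat_adjoint W) i \<bullet> col W j
      = (\<Sum>l<n. cnj (ws ! i $ l / complex_of_real (r i)) * (ws ! j $ l / complex_of_real (r j)))"
      using ij by (auto simp: W_def scalar_prod_def atLeast0LessThan intro!: sum.cong)
    also have "\<dots> = (\<Sum>l<n. ws ! j $ l * cnj (ws ! i $ l)) / (complex_of_real (r i) * complex_of_real (r j))"
      by (simp add: sum_divide_distrib mult.commute)
    also have "(\<Sum>l<n. ws ! j $ l * cnj (ws ! i $ l)) = ws ! j \<bullet>c ws ! i"
      using wsc[OF ij(1)] wsc[OF ij(2)] ij
      by (auto simp: scalar_prod_def atLeast0LessThan carrier_vecD intro!: sum.cong)
    also have "(ws ! j \<bullet>c ws ! i) / (complex_of_real (r i) * complex_of_real (r j)) = (if i = j then 1 else 0)"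
      using corthogonalD[OF ws(1), of j i] ij ws(3) r[OF ij(1)] by auto
    finally show "(mat_adjoint W * W) $$ (i, j) = 1\<^sub>m n $$ (i, j)"
      using W ij by simp
  qed (use W in auto)
  moreover have "col W 0 = (1 / complex_of_real (r 0)) \<cdot>\<^sub>v v"
    using n v by (intro eq_vecI) (auto simp: W_def ws0)
  ultimately show ?thesis using unitary_matI[OF W] by blast
qed

text \<open>Deflation, by induction on the list of roots: a unitary whose first column is an
  eigenvector for \<open>e\<close> splits off a 1 by 1 block, and the remaining block is Hermitian
  with the remaining roots. The diagonal follows the given order of \<open>es\<close>, so any
  ordering of the eigenvalues can be realized.\<close>

lemma hermitian_unitary_diagonalizable:
  fixes M :: "complex mat"
  assumes "M \<in> carrier_mat n n" "mat_adjoint M = M" "char_poly M = (\<Prod>e\<leftarrow>es. [:- e, 1:])"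
  shows "\<exists>U. unitary_mat n U \<and>
    mat_adjoint U * M * U = mat n n (\<lambda>(i, j). if i = j then es ! i else 0)"
  using assms
proof (induction es arbitrary: n M)
  case Nil
  then have "n = 0" using degree_monic_char_poly[of M n] by auto
  then show ?case using Nil by (intro exI[of _ "1\<^sub>m 0"]) (auto simp: unitary_mat_def intro!: eq_matI)
next
  case (Cons e es n M)
  note M = Cons.prems(1)
  have ev: "eigenvalue M e" using eigenvalue_root_char_poly[OF M] Cons.prems(3) by simp
  then obtain v where v: "v \<in> carrier_vec n" "v \<noteq> 0\<^sub>v n" "M *\<^sub>v v = e \<cdot>\<^sub>v v"
    using M by (auto simp: eigenvalue_def eigenvector_def)
  have "n \<noteq> 0" using v by auto
  then obtain m where n: "n = Suc m" by (cases n) auto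
  obtain W c where W: "unitary_mat n W" "col W 0 = c \<cdot>\<^sub>v v"
    using unitary_with_first_col[OF v(1,2)] n by auto
  note WD = unitary_matD[OF W(1)]
  define N where "N = mat_adjoint W * M * W"
  have N: "N \<in> carrier_mat n n" using M WD by (auto simp: N_def)
  have Nh: "mat_adjoint N = N"
    using hermitian_congruence[of M n W n] M WD(1) Cons.prems(2)
    unfolding N_def hermitian_mat_def by (auto simp del: assoc_mult_mat)
  have "M *\<^sub>v col W 0 = e \<cdot>\<^sub>v col W 0"
    unfolding W(2) using M v
    by (simp add: mult_mat_vec[of _ n n] smult_smult_assoc mult.commute)
  have W0: "col W 0 \<in> carrier_vec n" unfolding W(2) using v by simp
  have colN: "col N 0 = e \<cdot>\<^sub>v unit_vec n 0"
  proof -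
    have "col N 0 = (mat_adjoint W * M) *\<^sub>v col W 0"
      unfolding N_def using n WD M by (intro col_mult2[of _ n n _ n]) auto
    also have "\<dots> = mat_adjoint W *\<^sub>v (M *\<^sub>v col W 0)"
      using W0 WD M by (intro assoc_mult_mat_vec[of _ n n _ n]) auto
    also have "\<dots> = e \<cdot>\<^sub>v (mat_adjoint W *\<^sub>v col W 0)"
      unfolding \<open>M *\<^sub>v col W 0 = e \<cdot>\<^sub>v col W 0\<close> using WD W0 by (intro mult_mat_vec[of _ n n]) auto
    also have "mat_adjoint W *\<^sub>v col W 0 = col (mat_adjoint W * W) 0"
      using n WD by (intro col_mult2[symmetric, of _ n n _ n]) auto
    also have "\<dots> = unit_vec n 0" using WD n by simp
    finally show ?thesis .
  qed
  have N0: "N $$ (i, 0) = (if i = 0 then e else 0)" if "i < n" for i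
    using arg_cong[OF colN, of "\<lambda>v. v $ i"] that N n by auto
  \<comment> \<open>The first row vanishes off the diagonal because the first column does and
    \<open>N\<close> is Hermitian.\<close>
  have N0': "N $$ (0, i) = 0" if "i < n" "i \<noteq> 0" for i
    using mat_adjoint_index[of 0 N i] Nh N0[OF that(1)] that N n by simp
  define E where "E = mat 1 1 (\<lambda>_. e)"
  define K where "K = mat m m (\<lambda>(i, j). N $$ (Suc i, Suc j))"
  have E: "E \<in> carrier_mat 1 1" and K: "K \<in> carrier_mat m m" by (auto simp: E_def K_def)
  have Nblock: "N = four_block_mat E (0\<^sub>m 1 m) (0\<^sub>m m 1) K"
    by (rule eq_matI) (use N n N0 N0' in \<open>auto simp: E_def K_def\<close>)
  have Kh: "mat_adjoint K = K"
  proof (rule eq_matI; simp add: K_def)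
    fix i j assume "i < m" "j < m"
    then show "cnj (N $$ (Suc j, Suc i)) = N $$ (Suc i, Suc j)"
      using mat_adjoint_index[of "Suc i" N "Suc j"] Nh N n by simp
  qed
  have "similar_mat_wit N M (mat_adjoint W) W"
    using WD M N by (intro similar_mat_witI[of _ _ n]) (auto simp: N_def)
  then have "char_poly N = char_poly M"
    using char_poly_similar unfolding similar_mat_def by blast
  moreover have "char_poly N = char_poly E * char_poly K"
    unfolding Nblock by (rule char_poly_four_block_zeros_col[OF E _ K]) auto
  moreover have "char_poly E = [:- e, 1:]"
    by (simp add: E_def char_poly_defs det_def sign_def)
  ultimately have "[:- e, 1:] * char_poly K = [:- e, 1:] * (\<Prod>e\<leftarrow>es. [:- e, 1:])"
    using Cons.prems(3) by simp
  then have "char_poly K = (\<Prod>e\<leftarrow>es. [:- e, 1:])"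
    by (metis mult_cancel_left pCons_eq_0_iff zero_neq_one)
  from Cons.IH[OF K Kh this] obtain V where V: "unitary_mat m V"
    "mat_adjoint V * K * V = mat m m (\<lambda>(i, j). if i = j then es ! i else 0)" by blast
  note VD = unitary_matD[OF V(1)]
  \<comment> \<open>\<open>T\<close> lets the unitary \<open>V\<close> obtained for the smaller
    block act on the last \<open>m\<close> coordinates and fixes the first one.\<close>
  define T where "T = four_block_mat (1\<^sub>m 1) (0\<^sub>m 1 m) (0\<^sub>m m 1) V"
  have T: "T \<in> carrier_mat n n" using VD n by (auto simp: T_def)
  have Ta: "mat_adjoint T = four_block_mat (1\<^sub>m 1) (0\<^sub>m 1 m) (0\<^sub>m m 1) (mat_adjoint V)"
    by (rule eq_matI) (use VD in \<open>auto simp: T_def\<close>)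
  have "mat_adjoint T * T = four_block_mat (1\<^sub>m 1) (0\<^sub>m 1 m) (0\<^sub>m m 1) (1\<^sub>m m)"
    unfolding Ta unfolding T_def using VD
    by (subst mult_four_block_mat[of _ 1 1 _ m _ m _ _ 1 _ m]) auto
  also have "\<dots> = 1\<^sub>m n" by (rule eq_matI) (use n in auto)
  finally have "unitary_mat n T" using T by (intro unitary_matI)
  then have U: "unitary_mat n (W * T)" using W by (intro unitary_mat_mult)
  have "mat_adjoint T * N = four_block_mat E (0\<^sub>m 1 m) (0\<^sub>m m 1) (mat_adjoint V * K)"
    unfolding Ta Nblock using VD E K
    by (subst mult_four_block_mat[of _ 1 1 _ m _ m _ _ 1 _ m]) auto
  then have "mat_adjoint T * N * T = four_block_mat E (0\<^sub>m 1 m) (0\<^sub>m m 1) (mat_adjoint V * K * V)"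
    unfolding T_def using VD E K
    by (simp, subst mult_four_block_mat[of _ 1 1 _ m _ m _ _ 1 _ m]) auto
  also have "\<dots> = mat n n (\<lambda>(i, j). if i = j then (e # es) ! i else 0)"
    unfolding V(2) by (rule eq_matI) (use n in \<open>auto simp: E_def nth_Cons'\<close>)
  also have "mat_adjoint T * N * T = mat_adjoint (W * T) * M * (W * T)"
    using WD(1,4) T M
    by (simp add: N_def mat_adjoint_mult[of _ n n _ n] assoc_mult_mat[of _ n n _ n _ n]
        mult_carrier_mat[of _ n n _ n])
  finally show ?case using U by blast
qed

text \<open>Unitary congruence preserves being Hermitian, so each diagonal entry of the diagonalized
  matrix equals its own conjugate.\<close>

lemma hermitian_eigvals_real:
  assumes "hermitian_mat M" "M \<in> carrier_mat n n" "e \<in> set (eigvals M)"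
  shows "complex_of_real (Re e) = e"
proof -
  obtain U where U: "unitary_mat n U"
    "mat_adjoint U * M * U = mat n n (\<lambda>(i, j). if i = j then eigvals M ! i else 0)"
    using hermitian_unitary_diagonalizable[OF assms(2) hermitian_matD(1)[OF assms(1,2)] eigvals(1)[OF assms(2)]]
    by blast
  obtain i where i: "i < n" "eigvals M ! i = e"
    using assms(3) eigvals(2)[OF assms(2)] by (auto simp: in_set_conv_nth)
  have "hermitian_mat (mat_adjoint U * M * U)"
    using hermitian_congruence[OF assms(1,2) unitary_matD(1)[OF U(1)]] .
  from hermitian_matD(2)[OF this, of n i i] i U have "cnj e = e" by simp
  then show ?thesis by (metis Reals_cnj_iff of_real_Re)
qed

text \<open>Since the eigenvalues are real, \<open>Re\<close> in \<open>eig_desc\<close> loses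
  nothing, and sorting only permutes the linear factors. The diagonalization can therefore be taken
  in the order of \<open>eig_desc\<close>.\<close>

theorem spectral_theorem:
  assumes "hermitian_mat M" "M \<in> carrier_mat n n"
  shows "\<exists>U. unitary_mat n U \<and> M = U * diag_real n ((!) (eig_desc M)) * mat_adjoint U"
proof -
  note M = assms(2) and Mh = hermitian_matD(1)[OF assms]
  have "map (complex_of_real \<circ> Re) (eigvals M) = eigvals M"
    using hermitian_eigvals_real[OF assms] by (simp add: map_idI)
  then have "mset (map complex_of_real (eig_desc M)) = mset (eigvals M)"
    by (simp add: eig_desc_def) (metis mset_map multiset.map_comp)
  then have cp: "char_poly M = (\<Prod>e\<leftarrow>map complex_of_real (eig_desc M). [:- e, 1:])"
    using eigvals(1)[OF M] linear_prod_cong_mset by metis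
  obtain U where U: "unitary_mat n U" and
    eq: "mat_adjoint U * M * U = mat n n (\<lambda>(i, j). if i = j then map complex_of_real (eig_desc M) ! i else 0)"
    using hermitian_unitary_diagonalizable[OF M Mh cp] by blast
  note UD = unitary_matD[OF U]
  have "mat_adjoint U * M * U = diag_real n ((!) (eig_desc M))"
    unfolding eq by (rule eq_matI) (use M in auto)
  then have "U * diag_real n ((!) (eig_desc M)) * mat_adjoint U = U * (mat_adjoint U * M * U) * mat_adjoint U"
    by simp
  also have "\<dots> = U * mat_adjoint U * M * (U * mat_adjoint U)"
    using UD(1,4) M by (simp add: assoc_mult_mat[of _ n n _ n _ n] mult_carrier_mat[of _ n n _ n])
  also have "\<dots> = M" using UD M by simp
  finally show ?thesis using U by metis
qed

section \<open>Functional calculus, trace and eigenvalue comparison\<close>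

text \<open>Functional calculus in a fixed eigenbasis: for unitary \<open>U\<close>, keeping
  \<open>U\<close> and changing \<open>f\<close> produces square roots and positive parts of the
  same operator.\<close>

definition udiag :: "nat \<Rightarrow> complex mat \<Rightarrow> (nat \<Rightarrow> real) \<Rightarrow> complex mat" where
  "udiag n U f = U * diag_real n f * mat_adjoint U"

lemma udiag_carrier [simp, intro]: "U \<in> carrier_mat n n \<Longrightarrow> udiag n U f \<in> carrier_mat n n"
  by (auto simp: udiag_def)

lemma hermitian_udiag [simp, intro]: "U \<in> carrier_mat n n \<Longrightarrow> hermitian_mat (udiag n U f)"
  unfolding udiag_def by (rule hermitian_diag_congruence)

lemma qform_udiag:
  assumes "U \<in> carrier_mat n n" "v \<in> carrier_vec n"
  shows "qform (udiag n U f) v = (\<Sum>i<n. f i * (cmod ((mat_adjoint U *\<^sub>v v) $ i))\<^sup>2)"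
proof -
  have "qform (udiag n U f) v = qform (diag_real n f) (mat_adjoint U *\<^sub>v v)"
    using qform_congruence[of "mat_adjoint U" n n "diag_real n f" v] assms by (simp add: udiag_def)
  also have "\<dots> = (\<Sum>i<n. f i * (cmod ((mat_adjoint U *\<^sub>v v) $ i))\<^sup>2)"
    by (rule qform_diag_real, rule mult_mat_vec_carrier[of _ n n]) (use assms in auto)
  finally show ?thesis .
qed

lemma qform_udiag_mono:
  assumes "U \<in> carrier_mat n n" "v \<in> carrier_vec n" "\<And>i. i < n \<Longrightarrow> f i \<le> g i"
  shows "qform (udiag n U f) v \<le> qform (udiag n U g) v"
  unfolding qform_udiag[OF assms(1,2)] using assms(3) by (intro sum_mono mult_right_mono) auto

lemma qform_udiag_nonneg:
  assumes "U \<in> carrier_mat n n" "v \<in> carrier_vec n" "\<And>i. i < n \<Longrightarrow> 0 \<le> f i"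
  shows "0 \<le> qform (udiag n U f) v"
  unfolding qform_udiag[OF assms(1,2)] using assms(3) by (intro sum_nonneg mult_nonneg_nonneg) auto

lemma qform_udiag_const:
  assumes "unitary_mat n U" "v \<in> carrier_vec n"
  shows "qform (udiag n U (\<lambda>_. c)) v = c * norm2 v"
proof -
  note U = unitary_matD[OF assms(1)]
  have "norm2 (mat_adjoint U *\<^sub>v v) = norm2 v"
    using U assms(2) by (intro norm2_isometry[of _ n n]) auto
  then show ?thesis using U assms(2)
    by (simp add: qform_udiag norm2_def flip: sum_distrib_left)
qed

lemma qform_udiag_add:
  assumes "U \<in> carrier_mat n n" "v \<in> carrier_vec n"
  shows "qform (udiag n U (\<lambda>i. f i + g i)) v = qform (udiag n U f) v + qform (udiag n U g) v"
  unfolding qform_udiag[OF assms] by (simp add: sum.distrib algebra_simps)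

lemma udiag_mult:
  assumes "unitary_mat n U"
  shows "udiag n U f * udiag n U g = udiag n U (\<lambda>i. f i * g i)"
proof -
  note U = unitary_matD[OF assms]
  have "udiag n U f * udiag n U g
    = U * diag_real n f * (mat_adjoint U * U) * (diag_real n g * mat_adjoint U)"
    unfolding udiag_def using U(1,4)
    by (simp add: assoc_mult_mat[of _ n n _ n _ n] mult_carrier_mat[of _ n n _ n])
  also have "\<dots> = U * (diag_real n f * diag_real n g) * mat_adjoint U"
    unfolding U(2) using U(1,4)
    by (simp add: assoc_mult_mat[of _ n n _ n _ n] mult_carrier_mat[of _ n n _ n] del: diag_real_mult)
  finally show ?thesis by (simp add: udiag_def)
qed

lemma spectral_udiag:
  assumes "hermitian_mat M" "M \<in> carrier_mat n n"
  obtains U where "unitary_mat n U" "M = udiag n U ((!) (eig_desc M))"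
  using spectral_theorem[OF assms] unfolding udiag_def by blast

lemma qform_ge_if_eigs_ge:
  assumes "hermitian_mat M" "M \<in> carrier_mat n n" "\<And>\<mu>. \<mu> \<in> set (eig_desc M) \<Longrightarrow> a \<le> \<mu>"
    and v: "v \<in> carrier_vec n"
  shows "a * norm2 v \<le> qform M v"
proof -
  obtain U where U: "unitary_mat n U" "M = udiag n U ((!) (eig_desc M))"
    using spectral_udiag[OF assms(1,2)] .
  have "qform (udiag n U (\<lambda>_. a)) v \<le> qform (udiag n U ((!) (eig_desc M))) v"
    using assms by (intro qform_udiag_mono unitary_matD[OF U(1)] v) auto
  then show ?thesis using U v by (simp add: qform_udiag_const)
qed

lemma qform_le_if_eigs_le:
  assumes "hermitian_mat M" "M \<in> carrier_mat n n" "\<And>\<mu>. \<mu> \<in> set (eig_desc M) \<Longrightarrow> \<mu> \<le> a"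
    and v: "v \<in> carrier_vec n"
  shows "qform M v \<le> a * norm2 v"
proof -
  obtain U where U: "unitary_mat n U" "M = udiag n U ((!) (eig_desc M))"
    using spectral_udiag[OF assms(1,2)] .
  have "qform (udiag n U ((!) (eig_desc M))) v \<le> qform (udiag n U (\<lambda>_. a)) v"
    using assms by (intro qform_udiag_mono unitary_matD[OF U(1)] v) auto
  then show ?thesis using U v by (simp add: qform_udiag_const)
qed

section \<open>The trace\<close>

definition mtrace :: "complex mat \<Rightarrow> real" where
  "mtrace M = Re (\<Sum>i<dim_row M. M $$ (i, i))"

lemma mtrace_mult_comm:
  assumes "M \<in> carrier_mat n m" "N \<in> carrier_mat m n"
  shows "mtrace (M * N) = mtrace (N * M)"
proof -
  have "(\<Sum>i<n. (M * N) $$ (i, i)) = (\<Sum>i<n. \<Sum>j<m. M $$ (i, j) * N $$ (j, i))"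
    using assms by (auto simp: scalar_prod_def atLeast0LessThan intro!: sum.cong)
  also have "\<dots> = (\<Sum>j<m. \<Sum>i<n. M $$ (i, j) * N $$ (j, i))" by (rule sum.swap)
  also have "\<dots> = (\<Sum>j<m. (N * M) $$ (j, j))"
    using assms by (auto simp: scalar_prod_def atLeast0LessThan mult.commute intro!: sum.cong)
  finally show ?thesis using assms by (simp add: mtrace_def)
qed

lemma mtrace_add:
  "M \<in> carrier_mat n n \<Longrightarrow> N \<in> carrier_mat n n \<Longrightarrow> mtrace (M + N) = mtrace M + mtrace N"
  by (simp add: mtrace_def sum.distrib)

lemma mtrace_minus:
  "M \<in> carrier_mat n n \<Longrightarrow> N \<in> carrier_mat n n \<Longrightarrow> mtrace (M - N) = mtrace M - mtrace N"
  by (simp add: mtrace_def sum_subtractf)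

lemma mtrace_unitary_congruence:
  assumes "unitary_mat n U" "M \<in> carrier_mat n n"
  shows "mtrace (mat_adjoint U * M * U) = mtrace M"
proof -
  note U = unitary_matD[OF assms(1)]
  have "mtrace (mat_adjoint U * M * U) = mtrace (U * (mat_adjoint U * M))"
    using U(1,4) assms(2) by (intro mtrace_mult_comm) auto
  also have "U * (mat_adjoint U * M) = U * mat_adjoint U * M"
    using U(1,4) assms(2) by (simp add: assoc_mult_mat[of _ n n _ n _ n])
  finally show ?thesis using U(3) assms(2) by simp
qed

lemma mtrace_udiag:
  assumes "unitary_mat n U"
  shows "mtrace (udiag n U f) = (\<Sum>i<n. f i)"
proof -
  note U = unitary_matD[OF assms]
  have "unitary_mat n (mat_adjoint U)" using U by (auto simp: unitary_mat_def)
  from mtrace_unitary_congruence[OF this, of "diag_real n f"]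
  have "mtrace (udiag n U f) = mtrace (diag_real n f)" by (simp add: udiag_def)
  then show ?thesis by (simp add: mtrace_def)
qed

lemma mtrace_eq_sum_eig_desc:
  assumes "hermitian_mat M" "M \<in> carrier_mat n n"
  shows "mtrace M = (\<Sum>i<n. eig_desc M ! i)"
  using spectral_udiag[OF assms] mtrace_udiag by metis

lemma congruence_diag_entry:
  assumes "M \<in> carrier_mat n n" "K \<in> carrier_mat n k" "i < k"
  shows "Re ((mat_adjoint K * M * K) $$ (i, i)) = qform M (col K i)"
proof -
  have "(mat_adjoint K * M * K) $$ (i, i) = (mat_adjoint K * (M * K)) $$ (i, i)"
    using assms by (simp add: assoc_mult_mat[of _ k n _ n _ k])
  also have "\<dots> = row (mat_adjoint K) i \<bullet> col (M * K) i"
    using assms by (intro index_mult_mat) auto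
  also have "row (mat_adjoint K) i = conjugate (col K i)"
    using assms by (intro eq_vecI) auto
  also have "col (M * K) i = M *\<^sub>v col K i"
    using assms by (intro col_mult2) auto
  also have "conjugate (col K i) \<bullet> (M *\<^sub>v col K i) = (M *\<^sub>v col K i) \<bullet>c col K i"
    using assms(1,2) by (intro comm_scalar_prod[of _ n] carrier_vecI) auto
  finally show ?thesis by (simp add: qform_def)
qed

lemma mtrace_congruence:
  assumes "M \<in> carrier_mat n n" "K \<in> carrier_mat n k"
  shows "mtrace (mat_adjoint K * M * K) = (\<Sum>i<k. qform M (col K i))"
proof -
  have "dim_row (mat_adjoint K * M * K) = k" using assms by simp
  then show ?thesis unfolding mtrace_def Re_sum
    using congruence_diag_entry[OF assms] by (intro sum.cong) auto
qed

text \<open>The trace of the congruence is the sum of the form of \<open>M\<close> over the columns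
  of \<open>K\<close>, and the squared column norms add up to the trace of
  \<open>mat_adjoint K * K\<close>.\<close>

lemma mtrace_congruence_le:
  assumes "M \<in> carrier_mat n n" "K \<in> carrier_mat n k"
    and "\<And>v. v \<in> carrier_vec n \<Longrightarrow> qform M v \<le> m * norm2 v"
  shows "mtrace (mat_adjoint K * M * K) \<le> m * mtrace (mat_adjoint K * K)"
proof -
  have c: "col K i \<in> carrier_vec n" for i using assms(2) by (intro carrier_vecI) auto
  have "mtrace (mat_adjoint K * K) = mtrace (mat_adjoint K * 1\<^sub>m n * K)" using assms(2) by simp
  also have "\<dots> = (\<Sum>i<k. norm2 (col K i))"
    using mtrace_congruence[OF one_carrier_mat assms(2)] c by simp
  finally show ?thesis using mtrace_congruence[OF assms(1,2)] assms(3)[OF c]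
    by (simp add: sum_distrib_left sum_mono)
qed

section \<open>Dimension counting and eigenvalue comparison\<close>

text \<open>Padding with zero rows gives a square matrix \<open>S\<close> whose row \<open>p\<close>
  is zero, hence a singular one; a kernel vector of \<open>S\<close> is one of
  \<open>K\<close>.\<close>

lemma wide_mat_kernel:
  fixes K :: "complex mat"
  assumes "K \<in> carrier_mat p q" "p < q"
  shows "\<exists>w \<in> carrier_vec q. w \<noteq> 0\<^sub>v q \<and> K *\<^sub>v w = 0\<^sub>v p"
proof -
  define S where "S = mat q q (\<lambda>(i, j). if i < p then K $$ (i, j) else 0)"
  have S: "S \<in> carrier_mat q q" by (simp add: S_def)
  have "transpose_mat S *\<^sub>v unit_vec q p = 0\<^sub>v q"
    using assms by (intro eq_vecI) (auto simp: S_def)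
  moreover have "unit_vec q p \<noteq> (0\<^sub>v q :: complex vec)"
    using assms(2) by (metis index_unit_vec(1) index_zero_vec(1) zero_neq_one)
  ultimately have "det (transpose_mat S) = 0"
    using S by (subst det_0_iff_vec_prod_zero[of _ q]) (auto intro!: exI[of _ "unit_vec q p"])
  then have "det S = 0" using det_transpose[OF S] by simp
  then obtain w where w: "w \<in> carrier_vec q" "w \<noteq> 0\<^sub>v q" "S *\<^sub>v w = 0\<^sub>v q"
    using det_0_iff_vec_prod_zero[OF S] by blast
  have "K *\<^sub>v w = 0\<^sub>v p"
  proof (rule eq_vecI)
    fix i assume "i < dim_vec (0\<^sub>v p :: complex vec)"
    then have i: "i < p" by simp
    have "row S i = row K i" using i assms by (intro eq_vecI) (auto simp: S_def)
    then have "(K *\<^sub>v w) $ i = (S *\<^sub>v w) $ i" using i assms S by simp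
    then show "(K *\<^sub>v w) $ i = 0\<^sub>v p $ i" using w(3) i assms by simp
  qed (use assms in simp)
  with w show ?thesis by blast
qed

text \<open>A matrix with more columns than rows kills a nonzero vector, which an isometry cannot
  do.\<close>

lemma isometry_dim_le:
  fixes Y :: "complex mat"
  assumes "Y \<in> carrier_mat n k" "mat_adjoint Y * Y = 1\<^sub>m k"
  shows "k \<le> n"
proof (rule ccontr)
  assume "\<not> k \<le> n"
  then obtain w where w: "w \<in> carrier_vec k" "w \<noteq> 0\<^sub>v k" "Y *\<^sub>v w = 0\<^sub>v n"
    using wide_mat_kernel[OF assms(1)] by auto
  have "norm2 w = norm2 (0\<^sub>v n)" using norm2_isometry[OF assms w(1)] w(3) by simp
  then show False using norm2_pos[OF w(1,2)] by (simp add: norm2_def)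
qed

text \<open>Courant--Fischer in comparison form: it yields Weyl monotonicity when \<open>Y\<close> is the identity and
  Cauchy interlacing when \<open>N\<close> is the compression of \<open>M\<close> by \<open>Y\<close>. The test vector lies in the span of
  the top eigenvectors of \<open>N\<close> and its image is orthogonal to the top eigenvectors of \<open>M\<close>.\<close>

lemma eig_desc_compression_le:
  assumes N: "hermitian_mat N" "N \<in> carrier_mat k k" and M: "hermitian_mat M" "M \<in> carrier_mat n n"
    and Y: "Y \<in> carrier_mat n k" "mat_adjoint Y * Y = 1\<^sub>m k"
    and le: "\<And>v. v \<in> carrier_vec k \<Longrightarrow> qform N v \<le> qform M (Y *\<^sub>v v) + t * norm2 v"
    and i: "i < k"
  shows "eig_desc N ! i \<le> eig_desc M ! i + t"
proof -
  let ?a = "(!) (eig_desc N)" and ?b = "(!) (eig_desc M)"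
  have kn: "k \<le> n" using isometry_dim_le[OF Y] .
  obtain V where V: "unitary_mat k V" "N = udiag k V ?a" using spectral_udiag[OF N] .
  obtain U where U: "unitary_mat n U" "M = udiag n U ?b" using spectral_udiag[OF M] .
  note VD = unitary_matD[OF V(1)] and UD = unitary_matD[OF U(1)]
  \<comment> \<open>\<open>K\<close> converts coordinates in the eigenbasis of \<open>N\<close> into
    coordinates of the image under \<open>Y\<close> in the eigenbasis of \<open>M\<close>.\<close>
  define K where "K = mat_adjoint U * (Y * V)"
  have K: "K \<in> carrier_mat n k" using UD VD Y by (auto simp: K_def)
  \<comment> \<open>Indices start at 0: the first \<open>Suc i\<close> eigenvectors of
    \<open>N\<close> face only \<open>i\<close> orthogonality conditions, against the eigenvectors
    of \<open>M\<close> before position \<open>i\<close>. So a nonzero combination survives.\<close>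
  define L where "L = mat i (Suc i) (\<lambda>(l, r). K $$ (l, r))"
  have "L \<in> carrier_mat i (Suc i)" by (simp add: L_def)
  then obtain u where u: "u \<in> carrier_vec (Suc i)" "u \<noteq> 0\<^sub>v (Suc i)" "L *\<^sub>v u = 0\<^sub>v i"
    using wide_mat_kernel[of L i "Suc i"] by auto
  define w where "w = vec k (\<lambda>r. if r \<le> i then u $ r else 0)"
  have w: "w \<in> carrier_vec k" by (simp add: w_def)
  have "w \<noteq> 0\<^sub>v k"
  proof
    assume z: "w = 0\<^sub>v k"
    have "u $ r = 0" if "r < Suc i" for r
      using arg_cong[OF z, of "\<lambda>w. w $ r"] that i by (simp add: w_def)
    then show False using u(1,2) by (auto intro!: eq_vecI)
  qed
  then have pos: "norm2 w > 0" using norm2_pos[OF w] by simp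
  have Kw0: "(K *\<^sub>v w) $ l = 0" if l: "l < i" for l
  proof -
    have "(K *\<^sub>v w) $ l = (\<Sum>r<k. K $$ (l, r) * w $ r)"
      using l i kn K w by (auto simp: scalar_prod_def atLeast0LessThan intro!: sum.cong)
    also have "\<dots> = (\<Sum>r<Suc i. K $$ (l, r) * w $ r)"
      using i by (intro sum.mono_neutral_right) (auto simp: w_def)
    also have "\<dots> = (\<Sum>r<Suc i. K $$ (l, r) * u $ r)"
      using i by (intro sum.cong) (auto simp: w_def)
    also have "\<dots> = (L *\<^sub>v u) $ l"
      using l u(1) by (auto simp: L_def scalar_prod_def atLeast0LessThan simp del: sum.lessThan_Suc
          intro!: sum.cong)
    finally show ?thesis using u(3) l by simp
  qed
  define v where "v = V *\<^sub>v w"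
  have v: "v \<in> carrier_vec k" using VD w by (auto simp: v_def)
  have Vv: "mat_adjoint V *\<^sub>v v = w"
    unfolding v_def using VD w by (simp flip: assoc_mult_mat_vec[of _ k k _ k])
  have UYv: "mat_adjoint U *\<^sub>v (Y *\<^sub>v v) = K *\<^sub>v w"
    unfolding v_def K_def using VD UD Y w
    by (simp add: assoc_mult_mat_vec[of _ n k _ k] assoc_mult_mat_vec[of _ n n _ k])
  have nv: "norm2 v = norm2 w" unfolding v_def using VD w by (intro norm2_isometry[of _ k k]) auto
  have "norm2 (K *\<^sub>v w) = norm2 (Y *\<^sub>v v)"
    unfolding UYv[symmetric] using UD Y v by (intro norm2_isometry[of _ n n]) auto
  then have nK: "norm2 (K *\<^sub>v w) = norm2 w" using norm2_isometry[OF Y v] nv by simp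
  \<comment> \<open>\<open>w\<close> is supported on positions up to \<open>i\<close>, where the
    eigenvalues of \<open>N\<close> are at least \<open>?a i\<close>; \<open>K *\<^sub>v w\<close>
    is supported on positions from \<open>i\<close> on, where those of \<open>M\<close> are at most
    \<open>?b i\<close>.\<close>
  have "?a i * norm2 w = (\<Sum>r<k. ?a i * (cmod (w $ r))\<^sup>2)"
    using w by (simp add: norm2_def sum_distrib_left)
  also have "\<dots> \<le> (\<Sum>r<k. ?a r * (cmod (w $ r))\<^sup>2)"
  proof (rule sum_mono)
    fix r assume "r \<in> {..<k}"
    then show "?a i * (cmod (w $ r))\<^sup>2 \<le> ?a r * (cmod (w $ r))\<^sup>2"
      using eig_desc_antimono[of r i N] i N(2)
      by (cases "r \<le> i") (auto simp: w_def intro!: mult_right_mono)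
  qed
  also have "\<dots> = qform N v" using qform_udiag[OF VD(1) v, of ?a] V(2) Vv by simp
  also have "\<dots> \<le> qform M (Y *\<^sub>v v) + t * norm2 v" by (rule le[OF v])
  also have "qform M (Y *\<^sub>v v) = (\<Sum>l<n. ?b l * (cmod ((K *\<^sub>v w) $ l))\<^sup>2)"
    using qform_udiag[OF UD(1), of "Y *\<^sub>v v" ?b] U(2) UYv Y v by simp
  also have "\<dots> \<le> (\<Sum>l<n. ?b i * (cmod ((K *\<^sub>v w) $ l))\<^sup>2)"
  proof (rule sum_mono)
    fix l assume "l \<in> {..<n}"
    then show "?b l * (cmod ((K *\<^sub>v w) $ l))\<^sup>2 \<le> ?b i * (cmod ((K *\<^sub>v w) $ l))\<^sup>2"
      using eig_desc_antimono[of i l M] M(2) Kw0[of l]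
      by (cases "l < i") (auto intro!: mult_right_mono)
  qed
  also have "\<dots> = ?b i * norm2 (K *\<^sub>v w)"
    using K by (simp add: norm2_def sum_distrib_left)
  finally have "?a i * norm2 w \<le> (?b i + t) * norm2 w" using nK nv by (simp add: algebra_simps)
  then show ?thesis using pos by simp
qed

lemma eig_desc_mono:
  assumes "hermitian_mat N" "N \<in> carrier_mat k k" "hermitian_mat M" "M \<in> carrier_mat k k"
    and "\<And>v. v \<in> carrier_vec k \<Longrightarrow> qform N v \<le> qform M v + t * norm2 v" "i < k"
  shows "eig_desc N ! i \<le> eig_desc M ! i + t"
  using assms by (intro eig_desc_compression_le[of _ k _ k "1\<^sub>m k"]) auto

text \<open>Lidskii's inequality in the form used by the Li--Mathias argument: enlarging the index set \<open>J\<close>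
  to all indices costs nothing once the perturbation has been bounded by semidefinite terms, and the
  full sums are traces.\<close>

lemma sum_abs_eig_diff_le:
  assumes N: "hermitian_mat N" "N \<in> carrier_mat k k" and P: "hermitian_mat P" "P \<in> carrier_mat k k"
    and H: "hermitian_mat H" "H \<in> carrier_mat k k" and H': "hermitian_mat H'" "H' \<in> carrier_mat k k"
    and H_nonneg: "\<And>v. v \<in> carrier_vec k \<Longrightarrow> 0 \<le> qform H v"
    and H'_nonneg: "\<And>v. v \<in> carrier_vec k \<Longrightarrow> 0 \<le> qform H' v"
    and up: "\<And>v. v \<in> carrier_vec k \<Longrightarrow> qform N v \<le> qform P v + qform H v + t * norm2 v"
    and low: "\<And>v. v \<in> carrier_vec k \<Longrightarrow> qform P v \<le> qform N v + qform H' v + t * norm2 v"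
    and J: "J \<subseteq> {..<k}"
  shows "(\<Sum>i\<in>J. \<bar>eig_desc N ! i - eig_desc P ! i\<bar>) \<le> real (card J) * t + mtrace H + mtrace H'"
proof -
  let ?p = "(!) (eig_desc P)" and ?h = "(!) (eig_desc (P + H))" and ?h' = "(!) (eig_desc (P - H'))"
  have PH: "hermitian_mat (P + H)" "P + H \<in> carrier_mat k k"
    and PH': "hermitian_mat (P - H')" "P - H' \<in> carrier_mat k k"
    using P H H' by (auto intro: hermitian_add hermitian_minus)
  have h: "?p i \<le> ?h i" and h': "?h' i \<le> ?p i" if "i < k" for i
    using eig_desc_mono[OF P PH, of 0 i] eig_desc_mono[OF PH' P, of 0 i] that H_nonneg H'_nonneg P H H'
    by (simp_all add: qform_add[of _ k] qform_minus[of _ k])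
  have "eig_desc N ! i \<le> ?h i + t" if "i < k" for i
    using up P H by (intro eig_desc_mono[OF N PH _ that]) (simp add: qform_add[of _ k])
  moreover have "?h' i \<le> eig_desc N ! i + t" if "i < k" for i
    using low P H' by (intro eig_desc_mono[OF PH' N _ that]) (simp add: qform_minus[of _ k] algebra_simps)
  \<comment> \<open>Both brackets are nonnegative, so their sum covers either sign of the
    difference.\<close>
  ultimately have "\<bar>eig_desc N ! i - ?p i\<bar> \<le> t + (?h i - ?p i) + (?p i - ?h' i)" if "i < k" for i
    using h[OF that] h'[OF that] that by (smt (verit))
  then have "(\<Sum>i\<in>J. \<bar>eig_desc N ! i - ?p i\<bar>) \<le> (\<Sum>i\<in>J. t + (?h i - ?p i) + (?p i - ?h' i))"
    using J by (intro sum_mono) auto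
  also have "\<dots> = real (card J) * t + (\<Sum>i\<in>J. (?h i - ?p i) + (?p i - ?h' i))"
    by (simp add: sum.distrib add.assoc)
  also have "(\<Sum>i\<in>J. (?h i - ?p i) + (?p i - ?h' i)) \<le> (\<Sum>i<k. (?h i - ?p i) + (?p i - ?h' i))"
  proof (rule sum_mono2[OF _ J])
    fix i assume "i \<in> {..<k} - J"
    then show "0 \<le> (?h i - ?p i) + (?p i - ?h' i)" using h[of i] h'[of i] by simp
  qed simp
  also have "(\<Sum>i<k. (?h i - ?p i) + (?p i - ?h' i)) = mtrace (P + H) - mtrace (P - H')"
    using mtrace_eq_sum_eig_desc[OF PH] mtrace_eq_sum_eig_desc[OF PH'] by (simp add: sum_subtractf)
  also have "\<dots> = mtrace H + mtrace H'"
    using P H H' by (simp add: mtrace_add[of _ k] mtrace_minus[of _ k])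
  finally show ?thesis by simp
qed

section \<open>Perturbation bounds for compressions\<close>

lemma unitary_col:
  assumes "unitary_mat n U" "i < n"
  shows "col U i \<in> carrier_vec n" "qform (udiag n U f) (col U i) = f i" "norm2 (col U i) = 1"
proof -
  note U = unitary_matD[OF assms(1)]
  show c: "col U i \<in> carrier_vec n" using U(1) by (intro carrier_vecI) auto
  have "mat_adjoint U *\<^sub>v col U i = col (mat_adjoint U * U) i"
    using U(1,4) assms(2) by (intro col_mult2[symmetric, of _ n n _ n]) auto
  then have e: "mat_adjoint U *\<^sub>v col U i = unit_vec n i" using U(2) assms(2) by simp
  have *: "qform (udiag n U f) (col U i) = f i" for f
  proof -
    have "(\<Sum>j<n. f j * (cmod (unit_vec n i $ j))\<^sup>2) = (\<Sum>j<n. if i = j then f j else 0)"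
      using assms(2) by (intro sum.cong) auto
    then show ?thesis using assms(2) by (simp add: qform_udiag[OF U(1) c] e)
  qed
  show "qform (udiag n U f) (col U i) = f i" by (rule *)
  show "norm2 (col U i) = 1" using *[of "\<lambda>_. 1"] qform_udiag_const[OF assms(1) c, of 1] by simp
qed

text \<open>Converse to \<open>qform_ge_if_eigs_ge\<close>: at a unit eigenvector the form takes the
  eigenvalue itself.\<close>

lemma eigs_ge_if_qform_ge:
  assumes "hermitian_mat M" "M \<in> carrier_mat n n" "\<And>v. v \<in> carrier_vec n \<Longrightarrow> a * norm2 v \<le> qform M v"
    and "\<mu> \<in> set (eig_desc M)"
  shows "a \<le> \<mu>"
proof -
  obtain U where U: "unitary_mat n U" "M = udiag n U ((!) (eig_desc M))"
    using spectral_udiag[OF assms(1,2)] .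
  obtain i where i: "i < n" "eig_desc M ! i = \<mu>"
    using assms(2,4) by (auto simp: in_set_conv_nth)
  show ?thesis
    using assms(3)[of "col U i"] unitary_col(1,3)[OF U(1) i(1)] unitary_col(2)[OF U(1) i(1), of "(!) (eig_desc M)"] U(2) i(2)
    by simp
qed

lemma eigs_le_if_qform_le:
  assumes "hermitian_mat M" "M \<in> carrier_mat n n" "\<And>v. v \<in> carrier_vec n \<Longrightarrow> qform M v \<le> a * norm2 v"
    and "\<mu> \<in> set (eig_desc M)"
  shows "\<mu> \<le> a"
proof -
  obtain U where U: "unitary_mat n U" "M = udiag n U ((!) (eig_desc M))"
    using spectral_udiag[OF assms(1,2)] .
  obtain i where i: "i < n" "eig_desc M ! i = \<mu>"
    using assms(2,4) by (auto simp: in_set_conv_nth)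
  show ?thesis
    using assms(3)[of "col U i"] unitary_col(1,3)[OF U(1) i(1)] unitary_col(2)[OF U(1) i(1), of "(!) (eig_desc M)"] U(2) i(2)
    by simp
qed

text \<open>The scalar inequality \<open>1 \<le> c i + max 0 (1 - c i - t) + t\<close>, lifted to
  the operator with eigenvalues \<open>c i\<close>.\<close>

lemma norm2_le_threshold:
  assumes "unitary_mat n U" "v \<in> carrier_vec n"
  shows "norm2 v \<le> qform (udiag n U c) v + qform (udiag n U (\<lambda>i. max 0 (1 - c i - t))) v + t * norm2 v"
proof -
  note U = unitary_matD[OF assms(1)]
  have "norm2 v = qform (udiag n U (\<lambda>_. 1)) v" using qform_udiag_const[OF assms, of 1] by simp
  also have "\<dots> \<le> qform (udiag n U (\<lambda>i. (c i + max 0 (1 - c i - t)) + t)) v"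
    using U assms(2) by (intro qform_udiag_mono) auto
  finally show ?thesis
    by (simp only: qform_udiag_add[OF U(1) assms(2)] qform_udiag_const[OF assms])
qed

text \<open>With \<open>R\<close> the square root of \<open>M\<close>, the matrix
  \<open>mat_adjoint C * M * C\<close> has the eigenvalues of \<open>P\<close>, that is of
  \<open>S = C * mat_adjoint C\<close> compressed by \<open>R\<close>. Here \<open>P \<le> M\<close>
  since \<open>mat_adjoint C\<close> is a contraction, and \<open>M - P\<close> is at most
  \<open>H\<close> plus \<open>m * t\<close>, where \<open>H\<close> is \<open>R\<close> applied on
  both sides of the excess \<open>L\<close> of \<open>1 - S\<close> over \<open>t\<close>.\<close>

lemma sum_abs_eig_diff_contraction_le:
  assumes M: "hermitian_mat M" "M \<in> carrier_mat k k" and C: "C \<in> carrier_mat k k"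
    and M_nonneg: "\<And>v. v \<in> carrier_vec k \<Longrightarrow> 0 \<le> qform M v"
    and M_le: "\<And>v. v \<in> carrier_vec k \<Longrightarrow> qform M v \<le> m * norm2 v"
    and C_le: "\<And>v. v \<in> carrier_vec k \<Longrightarrow> norm2 (mat_adjoint C *\<^sub>v v) \<le> norm2 v"
    and m: "m \<ge> 0" and t: "t \<ge> 0" and J: "J \<subseteq> {..<k}"
  shows "(\<Sum>i\<in>J. \<bar>eig_desc M ! i - eig_desc (mat_adjoint C * M * C) ! i\<bar>)
    \<le> real (card J) * (m * t) + m * (\<Sum>i<k. max 0 (1 - eig_desc (mat_adjoint C * C) ! i - t))"
proof -
  define a where "a = (!) (eig_desc M)"
  define S where "S = C * mat_adjoint C"
  define c where "c = (!) (eig_desc S)"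
  have S: "hermitian_mat S" "S \<in> carrier_mat k k"
    using hermitian_gram[of "mat_adjoint C"] C by (auto simp: S_def)
  have c_eq: "c = (!) (eig_desc (mat_adjoint C * C))"
    using eig_desc_mult_comm[of C k "mat_adjoint C"] C by (simp add: c_def S_def)
  obtain U where U: "unitary_mat k U" "M = udiag k U a" using spectral_udiag[OF M] unfolding a_def .
  obtain V where V: "unitary_mat k V" "S = udiag k V c" using spectral_udiag[OF S] unfolding c_def .
  note UD = unitary_matD[OF U(1)] and VD = unitary_matD[OF V(1)]
  have a0: "a i \<ge> 0" if "i < k" for i
    using eigs_ge_if_qform_ge[OF M, of 0] M_nonneg M(2) that by (simp add: a_def)
  define R where "R = udiag k U (\<lambda>i. sqrt (a i))"
  have R: "R \<in> carrier_mat k k" "mat_adjoint R = R"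
    using UD hermitian_udiag[of U k] by (auto simp: R_def hermitian_mat_def)
  have udiag_cong: "udiag k W f = udiag k W g" if "\<And>i. i < k \<Longrightarrow> f i = g i" for f g W
    unfolding udiag_def using that by (intro arg_cong2[where f = "(*)"] refl eq_matI) auto
  have RR: "R * R = M"
    unfolding R_def U(2) using udiag_mult[OF U(1)] a0 by (simp cong: udiag_cong)
  define g where "g i = max 0 (1 - c i - t)" for i
  \<comment> \<open>\<open>K\<close> is the square root of \<open>L\<close>; it serves to bound the
    trace of \<open>H\<close>.\<close>
  define K where "K = udiag k V (\<lambda>i. sqrt (g i))"
  define L where "L = udiag k V g"
  have L: "L \<in> carrier_mat k k" "hermitian_mat L" using VD by (auto simp: L_def)
  have K: "K \<in> carrier_mat k k" "mat_adjoint K = K"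
    using VD hermitian_udiag[of V k] by (auto simp: K_def hermitian_mat_def)
  have g0: "g i \<ge> 0" for i by (simp add: g_def)
  have KK: "K * K = L"
    unfolding K_def L_def using udiag_mult[OF V(1)] g0 by simp
  define P where "P = mat_adjoint R * S * R"
  define H where "H = mat_adjoint R * L * R"
  have P: "hermitian_mat P" "P \<in> carrier_mat k k" and H: "hermitian_mat H" "H \<in> carrier_mat k k"
    using hermitian_congruence[OF S R(1)] hermitian_congruence[OF L(2,1) R(1)] S L R
    by (auto simp: P_def H_def simp del: assoc_mult_mat)
  have "eig_desc P = eig_desc (mat_adjoint C * M * C)"
  proof -
    have "P = (R * C) * (mat_adjoint C * R)"
      unfolding P_def S_def R(2) using R(1) C
      by (simp add: assoc_mult_mat[of _ k k _ k _ k] mult_carrier_mat[of _ k k _ k])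
    moreover have "mat_adjoint C * M * C = (mat_adjoint C * R) * (R * C)"
      unfolding RR[symmetric] using R(1) C
      by (simp add: assoc_mult_mat[of _ k k _ k _ k] mult_carrier_mat[of _ k k _ k])
    ultimately show ?thesis
      using eig_desc_mult_comm[OF mult_carrier_mat[OF R(1) C]
          mult_carrier_mat[OF mat_adjoint_carrier[OF C] R(1)]] by metis
  qed
  have Rv: "R *\<^sub>v v \<in> carrier_vec k" if "v \<in> carrier_vec k" for v
    using R(1) that by (rule mult_mat_vec_carrier)
  have qP: "qform P v = qform S (R *\<^sub>v v)" and qH: "qform H v = qform L (R *\<^sub>v v)"
    and qM: "qform M v = norm2 (R *\<^sub>v v)" if "v \<in> carrier_vec k" for v
    using qform_congruence[OF R(1) S(2) that] qform_congruence[OF R(1) L(1) that]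
      norm2_mult_vec[OF R(1) that] R(2) RR by (simp_all add: P_def H_def)
  \<comment> \<open>As \<open>P \<le> M\<close>, the perturbation is one-sided and the lower
    correction is zero.\<close>
  have "(\<Sum>i\<in>J. \<bar>eig_desc M ! i - eig_desc P ! i\<bar>) \<le> real (card J) * (m * t) + mtrace H + mtrace (0\<^sub>m k k)"
  proof (rule sum_abs_eig_diff_le[OF M P H _ _ _ _ _ _ J])
    show "hermitian_mat (0\<^sub>m k k)" by (auto simp: hermitian_mat_def intro!: eq_matI)
    fix v :: "complex vec" assume v: "v \<in> carrier_vec k"
    have z: "qform (0\<^sub>m k k) v = 0" using v by (simp add: qform_def scalar_prod_def)
    then show "0 \<le> qform (0\<^sub>m k k) v" by simp
    show "0 \<le> qform H v"
      unfolding qH[OF v] L_def using VD Rv[OF v] by (intro qform_udiag_nonneg) (auto simp: g_def)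
    have "t * norm2 (R *\<^sub>v v) \<le> m * t * norm2 v"
      using mult_left_mono[OF M_le[OF v] t] qM[OF v] by (simp add: algebra_simps)
    then show "qform M v \<le> qform P v + qform H v + m * t * norm2 v"
      using norm2_le_threshold[OF V(1) Rv[OF v], of c t] qM[OF v] qP[OF v] qH[OF v] V(2)
      by (simp add: L_def g_def[abs_def])
    have "qform S (R *\<^sub>v v) = norm2 (mat_adjoint C *\<^sub>v (R *\<^sub>v v))"
      using norm2_mult_vec[of "mat_adjoint C" k k "R *\<^sub>v v"] C Rv[OF v] by (simp add: S_def)
    then have "qform P v \<le> qform M v" using C_le[OF Rv[OF v]] qP[OF v] qM[OF v] by simp
    then show "qform P v \<le> qform M v + qform (0\<^sub>m k k) v + m * t * norm2 v"
      using z m t norm2_nonneg[of v] by (simp add: add_increasing2)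
  qed auto
  moreover have "mtrace (0\<^sub>m k k) = 0" by (simp add: mtrace_def)
  moreover have "mtrace H \<le> m * (\<Sum>i<k. g i)"
  proof -
    \<comment> \<open>Cyclicity of the trace swaps the two products, so that
      \<open>R * R = M\<close> ends up inside and the bound on the form of \<open>M\<close>
      applies.\<close>
    have "H = (R * K) * (K * R)"
      unfolding H_def KK[symmetric] R(2) using R(1) K(1)
      by (simp add: assoc_mult_mat[of _ k k _ k _ k] mult_carrier_mat[of _ k k _ k])
    then have "mtrace H = mtrace ((K * R) * (R * K))"
      using mtrace_mult_comm[of "R * K" k k "K * R"] R(1) K(1) by auto
    also have "(K * R) * (R * K) = mat_adjoint K * M * K"
      unfolding RR[symmetric] K(2) using R(1) K(1)
      by (simp add: assoc_mult_mat[of _ k k _ k _ k] mult_carrier_mat[of _ k k _ k])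
    also have "mtrace \<dots> \<le> m * mtrace (mat_adjoint K * K)"
      by (rule mtrace_congruence_le[OF M(2) K(1) M_le])
    also have "mtrace (mat_adjoint K * K) = (\<Sum>i<k. g i)"
      unfolding K(2) KK L_def by (rule mtrace_udiag[OF V(1)])
    finally show ?thesis .
  qed
  ultimately show ?thesis
    using \<open>eig_desc P = eig_desc (mat_adjoint C * M * C)\<close> by (simp add: g_def c_eq)
qed

text \<open>In the eigenbasis of \<open>F\<close>, cut off the positive and the negative part beyond
  \<open>m * t\<close>. Testing the hypothesis at the eigenvectors of \<open>F\<close> bounds both
  excesses by the form of \<open>L\<close>, and summing that form over an orthonormal basis gives
  the trace of \<open>L\<close>.\<close>

lemma sum_abs_eig_diff_perturb_le:
  assumes P: "hermitian_mat P" "P \<in> carrier_mat k k" and F: "hermitian_mat F" "F \<in> carrier_mat k k"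
    and S: "hermitian_mat S" "S \<in> carrier_mat k k"
    and F_le: "\<And>v. v \<in> carrier_vec k \<Longrightarrow> \<bar>qform F v\<bar> \<le> m * (norm2 v - qform S v)"
    and m: "m \<ge> 0" and t: "t \<ge> 0" and J: "J \<subseteq> {..<k}"
  shows "(\<Sum>i\<in>J. \<bar>eig_desc (P + F) ! i - eig_desc P ! i\<bar>)
    \<le> real (card J) * (m * t) + m * (\<Sum>i<k. max 0 (1 - eig_desc S ! i - t))"
proof -
  define f where "f = (!) (eig_desc F)"
  define c where "c = (!) (eig_desc S)"
  obtain Z where Z: "unitary_mat k Z" "F = udiag k Z f" using spectral_udiag[OF F] unfolding f_def .
  obtain V where V: "unitary_mat k V" "S = udiag k V c" using spectral_udiag[OF S] unfolding c_def .
  note ZD = unitary_matD[OF Z(1)] and VD = unitary_matD[OF V(1)]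
  define L where "L = udiag k V (\<lambda>i. max 0 (1 - c i - t))"
  have L: "L \<in> carrier_mat k k" using VD by (auto simp: L_def)
  define h h' where "h i = max 0 (f i - m * t)" and "h' i = max 0 (- f i - m * t)" for i
  define H H' where "H = udiag k Z h" and "H' = udiag k Z h'"
  have PF: "hermitian_mat (P + F)" "P + F \<in> carrier_mat k k" using P F by (auto intro: hermitian_add)
  have "(\<Sum>i\<in>J. \<bar>eig_desc (P + F) ! i - eig_desc P ! i\<bar>) \<le> real (card J) * (m * t) + mtrace H + mtrace H'"
  proof (rule sum_abs_eig_diff_le[OF PF P _ _ _ _ _ _ _ _ J])
    fix v :: "complex vec" assume v: "v \<in> carrier_vec k"
    show "0 \<le> qform H v" "0 \<le> qform H' v" unfolding H_def H'_def using ZD v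
      by (auto intro!: qform_udiag_nonneg simp: h_def h'_def)
    have "qform F v \<le> qform (udiag k Z (\<lambda>i. h i + m * t)) v"
      unfolding Z(2) using ZD v by (intro qform_udiag_mono) (auto simp: h_def)
    also have "\<dots> = qform H v + m * t * norm2 v"
      by (simp only: qform_udiag_add[OF ZD(1) v] qform_udiag_const[OF Z(1) v] H_def)
    finally show "qform (P + F) v \<le> qform P v + qform H v + m * t * norm2 v"
      using P F v by (simp add: qform_add[of _ k])
    have "0 \<le> qform (udiag k Z (\<lambda>i. (f i + h' i) + m * t)) v"
      using ZD v by (intro qform_udiag_nonneg) (auto simp: h'_def)
    also have "\<dots> = qform F v + qform H' v + m * t * norm2 v"
      by (simp only: qform_udiag_add[OF ZD(1) v] qform_udiag_const[OF Z(1) v] H'_def Z(2))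
    finally show "qform P v \<le> qform (P + F) v + qform H' v + m * t * norm2 v"
      using P F v by (simp add: qform_add[of _ k])
  qed (use ZD in \<open>auto simp: H_def H'_def\<close>)
  moreover have "mtrace H + mtrace H' \<le> m * (\<Sum>i<k. max 0 (1 - c i - t))"
  proof -
    \<comment> \<open>Because \<open>m * t \<ge> 0\<close>, at most one of \<open>h i\<close> and
      \<open>h' i\<close> is nonzero, and their sum is the excess of \<open>\<bar>f i\<bar>\<close>
      over \<open>m * t\<close>.\<close>
    have "h i + h' i \<le> m * qform L (col Z i)" if i: "i < k" for i
    proof -
      note z = unitary_col[OF Z(1) i]
      have "0 \<le> qform L (col Z i)"
        unfolding L_def using VD z(1) by (intro qform_udiag_nonneg) auto
      then have 1: "0 \<le> m * qform L (col Z i)" using m by simp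
      have "1 - qform S (col Z i) \<le> qform L (col Z i) + t"
        using norm2_le_threshold[OF V(1) z(1), of c t] z(3) V(2) by (simp add: L_def)
      then have "m * (1 - qform S (col Z i)) \<le> m * (qform L (col Z i) + t)"
        using m by (rule mult_left_mono)
      moreover have "\<bar>f i\<bar> \<le> m * (1 - qform S (col Z i))"
        using F_le[OF z(1)] z(2)[of f] z(3) Z(2) by simp
      ultimately have "\<bar>f i\<bar> - m * t \<le> m * qform L (col Z i)" by (simp add: algebra_simps)
      moreover have "0 \<le> m * t" using m t by simp
      ultimately show ?thesis using 1 unfolding h_def h'_def by (simp add: max_def abs_if split: if_splits)
    qed
    then have "(\<Sum>i<k. h i + h' i) \<le> m * (\<Sum>i<k. qform L (col Z i))"
      unfolding sum_distrib_left by (intro sum_mono) auto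
    moreover have "(\<Sum>i<k. qform L (col Z i)) = mtrace L"
      using mtrace_congruence[OF L ZD(1)] mtrace_unitary_congruence[OF Z(1) L] by simp
    moreover have "mtrace L = (\<Sum>i<k. max 0 (1 - c i - t))"
      unfolding L_def by (rule mtrace_udiag[OF V(1)])
    moreover have "mtrace H + mtrace H' = (\<Sum>i<k. h i + h' i)"
      unfolding H_def H'_def mtrace_udiag[OF Z(1)] by (simp add: sum.distrib)
    ultimately show ?thesis by simp
  qed
  ultimately show ?thesis by (simp add: c_def)
qed

text \<open>Optimising the threshold \<open>t\<close> turns the sum of excesses into a Ky Fan sum of the \<open>j\<close> largest
  values of \<open>1 - c i\<close>.\<close>

lemma threshold_le_top_sum:
  fixes c :: "nat \<Rightarrow> real"
  assumes bound: "\<And>t. t \<ge> 0 \<Longrightarrow> x \<le> real j * (m * t) + m * (\<Sum>i<k. max 0 (1 - c i - t))"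
    and c: "\<And>i. i < k \<Longrightarrow> 0 \<le> c i \<and> c i \<le> 1" "\<And>i l. i \<le> l \<Longrightarrow> l < k \<Longrightarrow> c l \<le> c i" and j: "j \<le> k"
  shows "x \<le> m * (\<Sum>i\<in>{k - j..<k}. 1 - c i)"
proof (cases "j = 0")
  case True
  \<comment> \<open>For \<open>j = 0\<close> the index \<open>k - j\<close> is out of range; the
    threshold 1 removes every excess instead.\<close>
  have "(\<Sum>i<k. max 0 (1 - c i - 1)) = 0" using c(1) by (intro sum.neutral) auto
  with bound[of 1] True show ?thesis by simp
next
  case False
  \<comment> \<open>Since \<open>c\<close> is nonincreasing, this is the \<open>j\<close>-th largest
    value of \<open>1 - c i\<close>. Only the last \<open>j\<close> indices keep an excess, and
    subtracting \<open>t\<close> from each cancels \<open>real j * t\<close> in the bound.\<close>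
  define t where "t = 1 - c (k - j)"
  have t: "t \<ge> 0" using c(1)[of "k - j"] j False by (auto simp: t_def)
  have "1 - c i - t \<le> 0" if "i < k - j" for i
    using c(2)[of i "k - j"] that j False by (auto simp: t_def)
  then have "(\<Sum>i<k. max 0 (1 - c i - t)) = (\<Sum>i\<in>{k - j..<k}. max 0 (1 - c i - t))"
    by (intro sum.mono_neutral_right) auto
  also have "\<dots> = (\<Sum>i\<in>{k - j..<k}. 1 - c i - t)"
    using c(2)[of "k - j"] by (intro sum.cong) (auto simp: t_def max_def)
  also have "\<dots> = (\<Sum>i\<in>{k - j..<k}. 1 - c i) - real j * t"
    using j by (simp add: sum_subtractf of_nat_diff)
  finally have eq: "(\<Sum>i<k. max 0 (1 - c i - t)) = (\<Sum>i\<in>{k - j..<k}. 1 - c i) - real j * t" .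
  show ?thesis using bound[OF t] unfolding eq by (simp add: algebra_simps)
qed

section \<open>Ritz values against an invariant subspace\<close>

text \<open>\<open>W\<close> is the part of \<open>Y\<close> orthogonal to the range of
  \<open>X\<close>, and the formula for its Gram matrix is Pythagoras.\<close>

lemma isometry_residual:
  fixes X Y :: "complex mat"
  assumes X: "X \<in> carrier_mat n k" "mat_adjoint X * X = 1\<^sub>m k"
    and Y: "Y \<in> carrier_mat n l" "mat_adjoint Y * Y = 1\<^sub>m l"
  defines "C \<equiv> mat_adjoint X * Y"
  defines "W \<equiv> Y - X * C"
  shows "mat_adjoint X * W = 0\<^sub>m k l" "mat_adjoint W * W = 1\<^sub>m l - mat_adjoint C * C"
    "mat_adjoint C = mat_adjoint Y * X"
proof -
  have C: "C \<in> carrier_mat k l" and W: "W \<in> carrier_mat n l" and XC: "X * C \<in> carrier_mat n l"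
    using X(1) Y(1) by (auto simp: C_def W_def)
  note Xa = mat_adjoint_carrier[OF X(1)] and Ya = mat_adjoint_carrier[OF Y(1)]
    and Ca = mat_adjoint_carrier[OF C]
  have "mat_adjoint X * W = mat_adjoint X * Y - mat_adjoint X * (X * C)"
    unfolding W_def by (rule mult_minus_distrib_mat[OF Xa Y(1) XC])
  also have "mat_adjoint X * (X * C) = mat_adjoint X * X * C"
    by (rule assoc_mult_mat[OF Xa X(1) C, symmetric])
  also have "\<dots> = C" using C X(2) by simp
  finally show XW: "mat_adjoint X * W = 0\<^sub>m k l" using C by (simp flip: C_def)
  show Cadj: "mat_adjoint C = mat_adjoint Y * X"
    unfolding C_def using mat_adjoint_mult[OF Xa Y(1)] by simp
  have "mat_adjoint W = mat_adjoint Y - mat_adjoint C * mat_adjoint X"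
    unfolding W_def using mat_adjoint_minus[OF Y(1) XC] mat_adjoint_mult[OF X(1) C] by simp
  then have "mat_adjoint W * W = mat_adjoint Y * W - mat_adjoint C * mat_adjoint X * W"
    using minus_mult_distrib_mat[OF Ya mult_carrier_mat[OF Ca Xa] W] by simp
  also have "mat_adjoint C * mat_adjoint X * W = 0\<^sub>m l l"
    using assoc_mult_mat[OF Ca Xa W] XW right_mult_zero_mat[OF Ca] by simp
  also have "mat_adjoint Y * W = mat_adjoint Y * Y - mat_adjoint Y * (X * C)"
    unfolding W_def by (rule mult_minus_distrib_mat[OF Ya Y(1) XC])
  also have "mat_adjoint Y * (X * C) = mat_adjoint C * C"
    using assoc_mult_mat[OF Ya X(1) C] Cadj by simp
  finally show "mat_adjoint W * W = 1\<^sub>m l - mat_adjoint C * C"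
    using Y(2) C by (intro eq_matI) (auto simp del: index_mult_mat(1))
qed

text \<open>The loss of squared norm is exactly the squared norm of the residual applied to
  \<open>v\<close>.\<close>

lemma isometry_product_contraction:
  assumes X: "X \<in> carrier_mat n k" "mat_adjoint X * X = 1\<^sub>m k"
    and Y: "Y \<in> carrier_mat n l" "mat_adjoint Y * Y = 1\<^sub>m l" and v: "v \<in> carrier_vec l"
  shows "norm2 ((mat_adjoint X * Y) *\<^sub>v v) \<le> norm2 v"
proof -
  let ?C = "mat_adjoint X * Y" and ?W = "Y - X * (mat_adjoint X * Y)"
  have C: "?C \<in> carrier_mat k l" and W: "?W \<in> carrier_mat n l" using X Y by auto
  have "norm2 (?W *\<^sub>v v) = qform (1\<^sub>m l - mat_adjoint ?C * ?C) v"
    using norm2_mult_vec[OF W v] isometry_residual(2)[OF X Y] by simp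
  also have "\<dots> = norm2 v - norm2 (?C *\<^sub>v v)"
    using qform_minus[OF one_carrier_mat mult_carrier_mat[OF mat_adjoint_carrier[OF C] C] v]
      norm2_mult_vec[OF C v] v by simp
  finally show ?thesis using norm2_nonneg[of "?W *\<^sub>v v"] by simp
qed

text \<open>The sum of the \<open>j\<close> largest squared sines of the principal angles. The
  eigenvalues are the squared cosines in nonincreasing order, so the largest sines sit at the last
  \<open>j\<close> positions. The link to \<open>princ_angles\<close> is
  \<open>sum_take_sin2_princ_angles\<close>.\<close>

definition top_sin2 :: "complex mat \<Rightarrow> complex mat \<Rightarrow> nat \<Rightarrow> real" where
  "top_sin2 X Y j = (\<Sum>i\<in>{dim_col Y - j..<dim_col Y}.
     1 - eig_desc (mat_adjoint (mat_adjoint X * Y) * (mat_adjoint X * Y)) ! i)"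

lemma cos2_bounds:
  assumes X: "X \<in> carrier_mat n k" "mat_adjoint X * X = 1\<^sub>m k"
    and Y: "Y \<in> carrier_mat n k" "mat_adjoint Y * Y = 1\<^sub>m k"
    and \<mu>: "\<mu> \<in> set (eig_desc (mat_adjoint (mat_adjoint X * Y) * (mat_adjoint X * Y)))"
  shows "0 \<le> \<mu>" "\<mu> \<le> 1"
proof -
  let ?C = "mat_adjoint X * Y"
  have C: "?C \<in> carrier_mat k k" using X Y by auto
  then have S: "mat_adjoint ?C * ?C \<in> carrier_mat k k" by (rule gram_carrier)
  have q: "qform (mat_adjoint ?C * ?C) v = norm2 (?C *\<^sub>v v)" if "v \<in> carrier_vec k" for v
    using norm2_mult_vec[OF C that] by simp
  show "0 \<le> \<mu>"
    using eigs_ge_if_qform_ge[OF hermitian_gram S _ \<mu>, of 0] q norm2_nonneg by simp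
  show "\<mu> \<le> 1"
    using eigs_le_if_qform_le[OF hermitian_gram S _ \<mu>, of 1] q isometry_product_contraction[OF X Y] by simp
qed

text \<open>Invariance of the range of \<open>X\<close> is expressed with the compression itself as
  the restriction. The matrix is called \<open>B\<close> because the bounds are applied to shifted
  and reflected copies of \<open>A\<close>.\<close>

locale ritz_pair =
  fixes B X Y :: "complex mat" and n k :: nat
  assumes B: "hermitian_mat B" "B \<in> carrier_mat n n"
    and X: "X \<in> carrier_mat n k" "mat_adjoint X * X = 1\<^sub>m k"
    and Y: "Y \<in> carrier_mat n k" "mat_adjoint Y * Y = 1\<^sub>m k"
    and inv: "B * X = X * (mat_adjoint X * B * X)"
begin

text \<open>\<open>Y = X * C + W\<close> splits \<open>Y\<close> along the invariant subspace and
  its orthogonal complement. \<open>P\<close> and \<open>F\<close> are what the two parts contribute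
  to the compression of \<open>B\<close> by \<open>Y\<close>.\<close>

definition "C = mat_adjoint X * Y"
definition "W = Y - X * C"
definition "M = mat_adjoint X * B * X"
definition "P = mat_adjoint C * M * C"
definition "F = mat_adjoint W * B * W"

lemma carriers: "C \<in> carrier_mat k k" "W \<in> carrier_mat n k" "M \<in> carrier_mat k k"
  "P \<in> carrier_mat k k" "F \<in> carrier_mat k k"
proof -
  show C: "C \<in> carrier_mat k k" using X Y by (auto simp: C_def)
  show W: "W \<in> carrier_mat n k" using X Y C by (auto simp: W_def)
  show M: "M \<in> carrier_mat k k"
    unfolding M_def by (rule congruence_carrier[OF B(2) X(1)])
  show "P \<in> carrier_mat k k"
    unfolding P_def by (rule congruence_carrier[OF M C])
  show "F \<in> carrier_mat k k"
    unfolding F_def by (rule congruence_carrier[OF B(2) W])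
qed

lemma hermitian: "hermitian_mat M" "hermitian_mat P" "hermitian_mat F"
  "hermitian_mat (mat_adjoint Y * B * Y)"
proof -
  show "hermitian_mat M" unfolding M_def by (rule hermitian_congruence[OF B X(1)])
  then show "hermitian_mat P" unfolding P_def by (rule hermitian_congruence[OF _ carriers(3,1)])
  show "hermitian_mat F" unfolding F_def by (rule hermitian_congruence[OF B carriers(2)])
  show "hermitian_mat (mat_adjoint Y * B * Y)" by (rule hermitian_congruence[OF B Y(1)])
qed

lemma residual: "mat_adjoint X * W = 0\<^sub>m k k" "mat_adjoint W * W = 1\<^sub>m k - mat_adjoint C * C"
  "mat_adjoint C = mat_adjoint Y * X"
  using isometry_residual[OF X Y] by (simp_all add: C_def W_def)

text \<open>The cross terms disappear because \<open>B\<close> maps the range of \<open>X\<close> to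
  itself and, being Hermitian, also preserves its orthogonal complement.\<close>

lemma compression_split: "mat_adjoint Y * B * Y = P + F"
proof -
  note Xa = mat_adjoint_carrier[OF X(1)] and Ya = mat_adjoint_carrier[OF Y(1)]
    and Ca = mat_adjoint_carrier[OF carriers(1)] and Wa = mat_adjoint_carrier[OF carriers(2)]
  note c = B(2) X(1) Y(1) Xa Ya Ca Wa carriers
  have YB: "mat_adjoint Y * B \<in> carrier_mat k n" using c by auto
  have XC: "X * C \<in> carrier_mat n k" using c by auto
  have "mat_adjoint W * B * X = mat_adjoint W * (X * M)"
    using assoc_mult_mat[OF Wa B(2) X(1)] inv by (simp add: M_def)
  also have "\<dots> = mat_adjoint W * X * M" using assoc_mult_mat[OF Wa X(1) carriers(3)] by simp
  also have "mat_adjoint W * X = 0\<^sub>m k k"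
    using arg_cong[OF residual(1), of mat_adjoint] mat_adjoint_mult[OF Xa carriers(2)]
    by (auto intro!: eq_matI)
  finally have WBX: "mat_adjoint W * B * X = 0\<^sub>m k k" using carriers by simp
  have WB: "mat_adjoint W * B \<in> carrier_mat k n" using c by auto
  have "F = mat_adjoint W * B * Y - mat_adjoint W * B * (X * C)"
    using mult_minus_distrib_mat[OF WB Y(1) XC] unfolding F_def W_def[symmetric] .
  also have "mat_adjoint W * B * (X * C) = 0\<^sub>m k k"
    using assoc_mult_mat[OF WB X(1) carriers(1)] WBX carriers(1) by simp
  finally have F1: "F = mat_adjoint W * B * Y"
    using WB Y(1) by (auto intro!: eq_matI simp del: index_mult_mat(1))
  have Wadj: "mat_adjoint W = mat_adjoint Y - mat_adjoint C * mat_adjoint X"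
    unfolding W_def using mat_adjoint_minus[OF Y(1) XC] mat_adjoint_mult[OF X(1) carriers(1)] by simp
  have CX: "mat_adjoint C * mat_adjoint X \<in> carrier_mat k n" using c by auto
  have BY: "B * Y \<in> carrier_mat n k" using c by auto
  \<comment> \<open>The adjoint of the invariance equation, which handles the other cross
    term.\<close>
  have XB: "mat_adjoint X * B = M * mat_adjoint X"
  proof -
    have "mat_adjoint (B * X) = mat_adjoint (X * M)" using inv by (simp add: M_def)
    then show ?thesis
      using mat_adjoint_mult[OF B(2) X(1)] mat_adjoint_mult[OF X(1) carriers(3)]
        hermitian_matD(1)[OF B] hermitian_matD(1)[OF hermitian(1) carriers(3)] by simp
  qed
  have "F = mat_adjoint W * (B * Y)" unfolding F1 by (rule assoc_mult_mat[OF Wa B(2) Y(1)])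
  also have "\<dots> = mat_adjoint Y * (B * Y) - mat_adjoint C * mat_adjoint X * (B * Y)"
    unfolding Wadj by (rule minus_mult_distrib_mat[OF Ya CX BY])
  also have "mat_adjoint Y * (B * Y) = mat_adjoint Y * B * Y"
    by (rule assoc_mult_mat[OF Ya B(2) Y(1), symmetric])
  also have "mat_adjoint C * mat_adjoint X * (B * Y) = mat_adjoint C * (mat_adjoint X * (B * Y))"
    by (rule assoc_mult_mat[OF Ca Xa BY])
  also have "mat_adjoint X * (B * Y) = mat_adjoint X * B * Y"
    by (rule assoc_mult_mat[OF Xa B(2) Y(1), symmetric])
  also have "\<dots> = M * (mat_adjoint X * Y)"
    unfolding XB by (rule assoc_mult_mat[OF carriers(3) Xa Y(1)])
  also have "mat_adjoint C * (M * (mat_adjoint X * Y)) = P"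
    unfolding P_def C_def[symmetric] by (rule assoc_mult_mat[OF Ca carriers(3,1), symmetric])
  finally have "F = mat_adjoint Y * B * Y - P" .
  moreover have "T = P' + F'" if "F' = T - P'" "P' \<in> carrier_mat k k" "T \<in> carrier_mat k k"
    for T P' F' :: "complex mat"
    using that by (intro eq_matI) auto
  ultimately show ?thesis using carriers(4) mult_carrier_mat[OF YB Y(1)] by blast
qed

lemma qform_M: "v \<in> carrier_vec k \<Longrightarrow> qform M v = qform B (X *\<^sub>v v)"
  unfolding M_def by (rule qform_congruence[OF X(1) B(2)])

lemma norm2_X: "v \<in> carrier_vec k \<Longrightarrow> norm2 (X *\<^sub>v v) = norm2 v"
  by (rule norm2_isometry[OF X])

lemma qform_F: "v \<in> carrier_vec k \<Longrightarrow> qform F v = qform B (W *\<^sub>v v)"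
  unfolding F_def by (rule qform_congruence[OF carriers(2) B(2)])

lemma norm2_W: "v \<in> carrier_vec k \<Longrightarrow> norm2 (W *\<^sub>v v) = norm2 v - qform (mat_adjoint C * C) v"
  using norm2_mult_vec[OF carriers(2)] residual(2)
    qform_minus[OF one_carrier_mat mult_carrier_mat[OF mat_adjoint_carrier[OF carriers(1)] carriers(1)]]
  by simp

text \<open>Squared cosines lie in the unit interval and are sorted, so a bound valid for every
  threshold can be optimized by \<open>threshold_le_top_sum\<close>.\<close>

lemma top_sin2_bound:
  assumes "\<And>t. t \<ge> 0 \<Longrightarrow>
      x \<le> real (card J) * (m * t) + m * (\<Sum>i<k. max 0 (1 - eig_desc (mat_adjoint C * C) ! i - t))"
    and "J \<subseteq> {..<k}"
  shows "x \<le> m * top_sin2 X Y (card J)"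
proof -
  have S: "mat_adjoint C * C \<in> carrier_mat k k" using carriers by auto
  have "x \<le> m * (\<Sum>i\<in>{k - card J..<k}. 1 - eig_desc (mat_adjoint C * C) ! i)"
  proof (rule threshold_le_top_sum[OF assms(1)])
    show "0 \<le> eig_desc (mat_adjoint C * C) ! i \<and> eig_desc (mat_adjoint C * C) ! i \<le> 1" if "i < k" for i
      using cos2_bounds[OF X Y, of "eig_desc (mat_adjoint C * C) ! i"] that length_eig_desc[OF S]
      by (simp flip: C_def)
    show "eig_desc (mat_adjoint C * C) ! l \<le> eig_desc (mat_adjoint C * C) ! i" if "i \<le> l" "l < k" for i l
      using eig_desc_antimono that length_eig_desc[OF S] by simp
    show "card J \<le> k" using card_mono[OF _ assms(2)] by simp
  qed
  then show ?thesis using Y by (simp add: top_sin2_def C_def)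
qed

lemma sum_abs_eig_M_P_le:
  assumes "\<And>v. v \<in> carrier_vec k \<Longrightarrow> 0 \<le> qform M v"
    and "\<And>v. v \<in> carrier_vec n \<Longrightarrow> qform B v \<le> m * norm2 v"
    and "m \<ge> 0" "J \<subseteq> {..<k}"
  shows "(\<Sum>i\<in>J. \<bar>eig_desc M ! i - eig_desc P ! i\<bar>) \<le> m * top_sin2 X Y (card J)"
proof (rule top_sin2_bound[OF _ assms(4)])
  fix t :: real assume t: "t \<ge> 0"
  have Xv: "X *\<^sub>v v \<in> carrier_vec n" if "v \<in> carrier_vec k" for v
    using X(1) that by (rule mult_mat_vec_carrier)
  \<comment> \<open>The contraction required is \<open>mat_adjoint C = mat_adjoint Y * X\<close>,
    hence the product of isometries with \<open>X\<close> and \<open>Y\<close> exchanged.\<close>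
  show "(\<Sum>i\<in>J. \<bar>eig_desc M ! i - eig_desc P ! i\<bar>)
    \<le> real (card J) * (m * t) + m * (\<Sum>i<k. max 0 (1 - eig_desc (mat_adjoint C * C) ! i - t))"
    unfolding P_def
    using assms(2)[OF Xv] qform_M norm2_X isometry_product_contraction[OF Y X]
    by (intro sum_abs_eig_diff_contraction_le[OF hermitian(1) carriers(3,1) assms(1) _ _ assms(3) t assms(4)])
       (auto simp: residual(3))
qed

text \<open>As \<open>B\<close> is positive semidefinite, so is \<open>F\<close>; each eigenvalue of
  \<open>P + F\<close> then lies between those of \<open>P\<close> and \<open>M\<close>, and
  replacing it by that of \<open>P\<close> only widens the gap.\<close>

lemma ritz_bound_extreme:
  assumes "\<And>v. v \<in> carrier_vec n \<Longrightarrow> 0 \<le> qform B v"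
    and "\<And>v. v \<in> carrier_vec n \<Longrightarrow> qform B v \<le> m * norm2 v"
    and "\<And>i. i < k \<Longrightarrow> eig_desc (mat_adjoint Y * B * Y) ! i \<le> eig_desc (mat_adjoint X * B * X) ! i"
    and "m \<ge> 0" and J: "J \<subseteq> {..<k}"
  shows "(\<Sum>i\<in>J. \<bar>eig_desc (mat_adjoint X * B * X) ! i - eig_desc (mat_adjoint Y * B * Y) ! i\<bar>)
    \<le> m * top_sin2 X Y (card J)"
proof -
  have Xv: "X *\<^sub>v v \<in> carrier_vec n" and Wv: "W *\<^sub>v v \<in> carrier_vec n" if "v \<in> carrier_vec k" for v
    using X(1) carriers(2) that by (auto intro: mult_mat_vec_carrier)
  have PF: "P + F \<in> carrier_mat k k" "hermitian_mat (P + F)"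
    using carriers hermitian(4) compression_split by auto
  have "eig_desc P ! i \<le> eig_desc (P + F) ! i + 0" if "i < k" for i
    using assms(1)[OF Wv] qform_F carriers
    by (intro eig_desc_mono[OF hermitian(2) carriers(4) PF(2,1) _ that]) (simp add: qform_add[of _ k])
  then have "(\<Sum>i\<in>J. \<bar>eig_desc M ! i - eig_desc (P + F) ! i\<bar>) \<le> (\<Sum>i\<in>J. \<bar>eig_desc M ! i - eig_desc P ! i\<bar>)"
    using J assms(3) unfolding compression_split M_def[symmetric] by (intro sum_mono) fastforce
  also have "\<dots> \<le> m * top_sin2 X Y (card J)"
    using assms(1)[OF Xv] qform_M by (intro sum_abs_eig_M_P_le assms) auto
  finally show ?thesis unfolding compression_split M_def[symmetric] .
qed

text \<open>Triangle inequality through the eigenvalues of \<open>P\<close>: the contraction step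
  and the perturbation by \<open>F\<close> cost \<open>m\<close> times the squared sines
  each.\<close>

lemma ritz_bound_half:
  assumes "\<And>v. v \<in> carrier_vec n \<Longrightarrow> \<bar>qform B v\<bar> \<le> m * norm2 v"
    and "\<And>v. v \<in> carrier_vec k \<Longrightarrow> 0 \<le> qform (mat_adjoint X * B * X) v"
    and "m \<ge> 0" and J: "J \<subseteq> {..<k}"
  shows "(\<Sum>i\<in>J. \<bar>eig_desc (mat_adjoint X * B * X) ! i - eig_desc (mat_adjoint Y * B * Y) ! i\<bar>)
    \<le> 2 * m * top_sin2 X Y (card J)"
proof -
  have Wv: "W *\<^sub>v v \<in> carrier_vec n" if "v \<in> carrier_vec k" for v
    using carriers(2) that by (auto intro: mult_mat_vec_carrier)
  have S: "mat_adjoint C * C \<in> carrier_mat k k" using carriers by auto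
  have "\<bar>qform F v\<bar> \<le> m * (norm2 v - qform (mat_adjoint C * C) v)" if "v \<in> carrier_vec k" for v
    using assms(1)[OF Wv[OF that]] qform_F[OF that] norm2_W[OF that] by simp
  then have 2: "(\<Sum>i\<in>J. \<bar>eig_desc (P + F) ! i - eig_desc P ! i\<bar>) \<le> m * top_sin2 X Y (card J)"
    by (intro top_sin2_bound[OF _ J] sum_abs_eig_diff_perturb_le[OF hermitian(2) carriers(4) hermitian(3)
        carriers(5) hermitian_gram S _ assms(3) _ J])
  have 1: "(\<Sum>i\<in>J. \<bar>eig_desc M ! i - eig_desc P ! i\<bar>) \<le> m * top_sin2 X Y (card J)"
    using assms(1,2) by (intro sum_abs_eig_M_P_le assms(3) J) (fastforce simp: M_def)+
  have "(\<Sum>i\<in>J. \<bar>eig_desc M ! i - eig_desc (P + F) ! i\<bar>)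
    \<le> (\<Sum>i\<in>J. \<bar>eig_desc M ! i - eig_desc P ! i\<bar> + \<bar>eig_desc (P + F) ! i - eig_desc P ! i\<bar>)"
    by (intro sum_mono) linarith
  also have "\<dots> \<le> 2 * m * top_sin2 X Y (card J)" using 1 2 by (simp add: sum.distrib)
  finally show ?thesis unfolding compression_split M_def[symmetric] .
qed

end

section \<open>Affine normalisation\<close>

text \<open>One form for both normalisations: \<open>b = 1\<close> shifts the spectrum,
  \<open>b = -1\<close> reflects it and exchanges top and bottom.\<close>

definition affine_mat :: "real \<Rightarrow> real \<Rightarrow> complex mat \<Rightarrow> complex mat" where
  "affine_mat b a M = complex_of_real b \<cdot>\<^sub>m M + complex_of_real a \<cdot>\<^sub>m 1\<^sub>m (dim_row M)"

lemma affine_mat_carrier [simp, intro]: "M \<in> carrier_mat n n \<Longrightarrow> affine_mat b a M \<in> carrier_mat n n"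
  by (auto simp: affine_mat_def)

lemma hermitian_affine_mat:
  "hermitian_mat M \<Longrightarrow> M \<in> carrier_mat n n \<Longrightarrow> hermitian_mat (affine_mat b a M)"
  unfolding affine_mat_def by (rule hermitian_add[of _ _ n]) (auto intro: hermitian_smult)

lemma qform_affine_mat:
  assumes "M \<in> carrier_mat n n" "v \<in> carrier_vec n"
  shows "qform (affine_mat b a M) v = b * qform M v + a * norm2 v"
  using assms by (simp add: affine_mat_def qform_add[of _ n] qform_smult[of _ n])

lemma mult_affine_mat:
  fixes X :: "complex mat"
  assumes "M \<in> carrier_mat n n" "X \<in> carrier_mat n k"
  shows "affine_mat b a M * X = complex_of_real b \<cdot>\<^sub>m (M * X) + complex_of_real a \<cdot>\<^sub>m X"
proof -
  have "affine_mat b a M * X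
    = (complex_of_real b \<cdot>\<^sub>m M) * X + (complex_of_real a \<cdot>\<^sub>m 1\<^sub>m n) * X"
    unfolding affine_mat_def using assms by (auto intro: add_mult_distrib_mat[of _ n n _ _ k])
  also have "(complex_of_real b \<cdot>\<^sub>m M) * X = complex_of_real b \<cdot>\<^sub>m (M * X)"
    using assms by (intro mult_smult_assoc_mat) auto
  also have "(complex_of_real a \<cdot>\<^sub>m 1\<^sub>m n) * X = complex_of_real a \<cdot>\<^sub>m X"
    using assms mult_smult_assoc_mat[of "1\<^sub>m n" n n X k "complex_of_real a"] by simp
  finally show ?thesis .
qed

lemma affine_mat_mult:
  fixes X :: "complex mat"
  assumes "M \<in> carrier_mat k k" "X \<in> carrier_mat n k"
  shows "X * affine_mat b a M = complex_of_real b \<cdot>\<^sub>m (X * M) + complex_of_real a \<cdot>\<^sub>m X"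
proof -
  have "X * affine_mat b a M
    = X * (complex_of_real b \<cdot>\<^sub>m M) + X * (complex_of_real a \<cdot>\<^sub>m 1\<^sub>m k)"
    unfolding affine_mat_def using assms by (auto intro: mult_add_distrib_mat[of _ n k _ k])
  also have "X * (complex_of_real b \<cdot>\<^sub>m M) = complex_of_real b \<cdot>\<^sub>m (X * M)"
    using assms by (intro mult_smult_distrib) auto
  also have "X * (complex_of_real a \<cdot>\<^sub>m 1\<^sub>m k) = complex_of_real a \<cdot>\<^sub>m X"
    using assms mult_smult_distrib[of X n k "1\<^sub>m k" k "complex_of_real a"] by simp
  finally show ?thesis .
qed

lemma congruence_affine_mat:
  assumes "M \<in> carrier_mat n n" "X \<in> carrier_mat n k" "mat_adjoint X * X = 1\<^sub>m k"
  shows "mat_adjoint X * affine_mat b a M * X = affine_mat b a (mat_adjoint X * M * X)"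
proof -
  note Xa = mat_adjoint_carrier[OF assms(2)]
  have MX: "M * X \<in> carrier_mat n k" using assms by auto
  have d: "dim_row (mat_adjoint X * M * X) = k" using assms by simp
  have "mat_adjoint X * affine_mat b a M * X = mat_adjoint X * (affine_mat b a M * X)"
    by (rule assoc_mult_mat[OF Xa affine_mat_carrier[OF assms(1)] assms(2)])
  also have "\<dots> = mat_adjoint X * (complex_of_real b \<cdot>\<^sub>m (M * X)) + mat_adjoint X * (complex_of_real a \<cdot>\<^sub>m X)"
    unfolding mult_affine_mat[OF assms(1,2)]
    by (rule mult_add_distrib_mat[OF Xa smult_carrier_mat[OF MX] smult_carrier_mat[OF assms(2)]])
  also have "mat_adjoint X * (complex_of_real b \<cdot>\<^sub>m (M * X)) = complex_of_real b \<cdot>\<^sub>m (mat_adjoint X * (M * X))"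
    by (rule mult_smult_distrib[OF Xa MX])
  also have "mat_adjoint X * (complex_of_real a \<cdot>\<^sub>m X) = complex_of_real a \<cdot>\<^sub>m 1\<^sub>m k"
    using mult_smult_distrib[OF Xa assms(2)] assms(3) by simp
  also have "mat_adjoint X * (M * X) = mat_adjoint X * M * X"
    by (rule assoc_mult_mat[OF Xa assms(1,2), symmetric])
  finally show ?thesis unfolding affine_mat_def d .
qed

text \<open>The eigenbasis stays the same. Only multisets are compared here, since the sign of
  \<open>b\<close> decides whether the order is kept or reversed.\<close>

lemma mset_eig_desc_affine_mat:
  assumes "hermitian_mat M" "M \<in> carrier_mat n n"
  shows "mset (eig_desc (affine_mat b a M)) = mset (map (\<lambda>x. b * x + a) (eig_desc M))"
proof -
  let ?f = "\<lambda>i. b * eig_desc M ! i + a" and ?D = "diag_real n ((!) (eig_desc M))"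
  obtain U where U: "unitary_mat n U" "M = udiag n U ((!) (eig_desc M))" using spectral_udiag[OF assms] .
  note UD = unitary_matD[OF U(1)]
  have "diag_real n ?f = affine_mat b a ?D" by (rule eq_matI) (auto simp: affine_mat_def)
  then have "affine_mat b a M = U * diag_real n ?f * mat_adjoint U"
    using congruence_affine_mat[of ?D n "mat_adjoint U" n b a] UD U(2) by (simp add: udiag_def)
  then have "mset (eig_desc (affine_mat b a M)) = mset (map ?f [0..<n])"
    using UD by (intro mset_eig_desc_similar_diag[of U n "mat_adjoint U"]) auto
  also have "map ?f [0..<n] = map (\<lambda>x. b * x + a) (eig_desc M)"
    using assms(2) by (intro nth_equalityI) auto
  finally show ?thesis .
qed

lemma eig_desc_shift:
  assumes "hermitian_mat M" "M \<in> carrier_mat n n" "i < n"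
  shows "eig_desc (affine_mat 1 a M) ! i = eig_desc M ! i + a"
proof -
  have "sorted (map (\<lambda>x. x + a) (rev (eig_desc M)))"
    unfolding sorted_map by (rule sorted_wrt_mono_rel[OF _ sorted_rev_eig_desc]) simp
  then have "eig_desc (affine_mat 1 a M) = map (\<lambda>x. x + a) (eig_desc M)"
    using mset_eig_desc_affine_mat[OF assms(1,2), of 1 a]
    by (intro desc_list_unique) (simp_all add: rev_map)
  then show ?thesis using assms by simp
qed

lemma eig_desc_reflect:
  assumes "hermitian_mat M" "M \<in> carrier_mat n n" "i < n"
  shows "eig_desc (affine_mat (-1) a M) ! i = a - eig_desc M ! (n - 1 - i)"
proof -
  have "sorted_wrt (\<lambda>x y. a - x \<le> a - y) (eig_desc M)"
    using sorted_rev_eig_desc[of M] by (simp add: sorted_wrt_rev)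
  then have "sorted (map (\<lambda>x. a - x) (eig_desc M))" unfolding sorted_map .
  then have "eig_desc (affine_mat (-1) a M) = rev (map (\<lambda>x. a - x) (eig_desc M))"
    using mset_eig_desc_affine_mat[OF assms(1,2), of "-1" a]
    by (intro desc_list_unique) simp_all
  then show ?thesis using assms by (simp add: rev_nth)
qed

text \<open>The index reversal \<open>r\<close> is an involution and preserves cardinalities, and
  the bound depends on \<open>J\<close> only through \<open>card J\<close>.\<close>

lemma sum_abs_reflect:
  fixes x y :: "nat \<Rightarrow> real"
  assumes "\<And>J. J \<subseteq> {..<k} \<Longrightarrow> (\<Sum>i\<in>J. \<bar>(a - x (k - 1 - i)) - (a - y (k - 1 - i))\<bar>) \<le> f (card J)"
    and J: "J \<subseteq> {..<k}"
  shows "(\<Sum>i\<in>J. \<bar>x i - y i\<bar>) \<le> f (card J)"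
proof -
  define r where "r i = k - 1 - i" for i
  have r: "r i < k" "r (r i) = i" if "i \<in> J" for i using J that by (auto simp: r_def)
  have inj: "inj_on r J" using r(2) by (metis inj_onI)
  have "r ` J \<subseteq> {..<k}" using r(1) by auto
  from assms(1)[OF this] have "(\<Sum>i\<in>r ` J. \<bar>(a - x (r i)) - (a - y (r i))\<bar>) \<le> f (card J)"
    using card_image[OF inj] by (simp only: r_def[symmetric])
  then have "(\<Sum>i\<in>J. \<bar>(a - x (r (r i))) - (a - y (r (r i)))\<bar>) \<le> f (card J)"
    by (simp only: sum.reindex[OF inj] o_def)
  moreover have "(\<Sum>i\<in>J. \<bar>(a - x (r (r i))) - (a - y (r (r i)))\<bar>) = (\<Sum>i\<in>J. \<bar>x i - y i\<bar>)"
    using r(2) by (intro sum.cong) (auto simp: abs_minus_commute)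
  ultimately show ?thesis by simp
qed

section \<open>Cauchy interlacing and eigenvalues on spanned subspaces\<close>

lemma cauchy_upper:
  assumes "hermitian_mat A" "A \<in> carrier_mat n n" "Y \<in> carrier_mat n k" "mat_adjoint Y * Y = 1\<^sub>m k" "i < k"
  shows "eig_desc (mat_adjoint Y * A * Y) ! i \<le> eig_desc A ! i"
  using eig_desc_compression_le[OF hermitian_congruence[OF assms(1-3)] congruence_carrier[OF assms(2,3)]
      assms(1-4) _ assms(5), of 0] qform_congruence[OF assms(3,2)] by simp

text \<open>The upper half for \<open>-A\<close>: negation turns position \<open>k - 1 - i\<close>
  into position \<open>n - k + i\<close> for \<open>A\<close> and into position \<open>i\<close> for
  the compression.\<close>

lemma cauchy_lower:
  assumes A: "hermitian_mat A" "A \<in> carrier_mat n n"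
    and Y: "Y \<in> carrier_mat n k" "mat_adjoint Y * Y = 1\<^sub>m k" and i: "i < k"
  shows "eig_desc A ! (n - k + i) \<le> eig_desc (mat_adjoint Y * A * Y) ! i"
proof -
  have kn: "k \<le> n" by (rule isometry_dim_le[OF Y])
  have "eig_desc (mat_adjoint Y * affine_mat (-1) 0 A * Y) ! (k - 1 - i) \<le> eig_desc (affine_mat (-1) 0 A) ! (k - 1 - i)"
    using i by (intro cauchy_upper[OF hermitian_affine_mat[OF A] affine_mat_carrier[OF A(2)] Y]) auto
  moreover have "n - 1 - (k - 1 - i) = n - k + i" "k - 1 - (k - 1 - i) = i" using i kn by auto
  ultimately show ?thesis
    using i kn eig_desc_reflect[OF A, of "k - 1 - i" 0]
      eig_desc_reflect[OF hermitian_congruence[OF A Y(1)] congruence_carrier[OF A(2) Y(1)], of "k - 1 - i" 0]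
    by (simp add: congruence_affine_mat[OF A(2) Y])
qed

text \<open>From \<open>X = V * Q\<close> follows that \<open>Q\<close> is inverse to
  \<open>mat_adjoint X * V\<close>. With \<open>A * V = V * diag_real k \<mu>\<close> the
  compression becomes similar to the diagonal matrix.\<close>

lemma mset_eig_desc_spanned:
  fixes A X V Q :: "complex mat"
  assumes A: "A \<in> carrier_mat n n" and X: "X \<in> carrier_mat n k" "mat_adjoint X * X = 1\<^sub>m k"
    and V: "V \<in> carrier_mat n k" and Q: "Q \<in> carrier_mat k k" and XVQ: "X = V * Q"
    and ev: "\<And>i. i < k \<Longrightarrow> A *\<^sub>v col V i = complex_of_real (\<mu> i) \<cdot>\<^sub>v col V i"
  shows "mset (eig_desc (mat_adjoint X * A * X)) = mset (map \<mu> [0..<k])"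
proof -
  note Xa = mat_adjoint_carrier[OF X(1)]
  have AV: "A * V = V * diag_real k \<mu>"
  proof (rule mat_col_eqI)
    fix i assume "i < dim_col (V * diag_real k \<mu>)"
    then have i: "i < k" by simp
    have "col (A * V) i = complex_of_real (\<mu> i) \<cdot>\<^sub>v col V i"
      using col_mult2[OF A V i] ev[OF i] by simp
    also have "\<dots> = col (V * diag_real k \<mu>) i"
    proof (rule eq_vecI)
      fix r assume "r < dim_vec (col (V * diag_real k \<mu>) i)"
      then have r: "r < n" using V by simp
      have "col (V * diag_real k \<mu>) i $ r = (\<Sum>j<k. V $$ (r, j) * diag_real k \<mu> $$ (j, i))"
        using V r i by (auto simp: scalar_prod_def atLeast0LessThan intro!: sum.cong)
      also have "\<dots> = (\<Sum>j<k. if j = i then V $$ (r, j) * complex_of_real (\<mu> j) else 0)"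
        using i by (intro sum.cong) auto
      also have "\<dots> = V $$ (r, i) * complex_of_real (\<mu> i)" using i by simp
      finally show "(complex_of_real (\<mu> i) \<cdot>\<^sub>v col V i) $ r = col (V * diag_real k \<mu>) i $ r"
        using V r i by simp
    qed (use V in auto)
    finally show "col (A * V) i = col (V * diag_real k \<mu>) i" .
  qed (use A V in auto)
  have XV: "mat_adjoint X * V \<in> carrier_mat k k" using Xa V by auto
  have 1: "mat_adjoint X * V * Q = 1\<^sub>m k"
    using assoc_mult_mat[OF Xa V Q] X(2) XVQ by metis
  have "mat_adjoint X * A * X = mat_adjoint X * (A * V * Q)"
    using assoc_mult_mat[OF Xa A X(1)] assoc_mult_mat[OF A V Q] XVQ by metis
  also have "\<dots> = mat_adjoint X * (V * (diag_real k \<mu> * Q))"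
    unfolding AV using assoc_mult_mat[OF V diag_real_carrier Q] by simp
  also have "\<dots> = mat_adjoint X * V * (diag_real k \<mu> * Q)"
    by (rule assoc_mult_mat[OF Xa V mult_carrier_mat[OF diag_real_carrier Q], symmetric])
  also have "\<dots> = mat_adjoint X * V * diag_real k \<mu> * Q"
    by (rule assoc_mult_mat[OF XV diag_real_carrier Q, symmetric])
  finally show ?thesis by (rule mset_eig_desc_similar_diag[OF XV Q 1])
qed

text \<open>A contiguous run of a sorted list is sorted, so equality of multisets gives equality at
  each position. The offset \<open>p\<close> is \<open>0\<close> for the top block and
  \<open>n - k\<close> for the bottom block.\<close>

lemma eig_desc_spanned:
  fixes A X V Q :: "complex mat"
  assumes A: "A \<in> carrier_mat n n" and X: "X \<in> carrier_mat n k" "mat_adjoint X * X = 1\<^sub>m k"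
    and V: "V \<in> carrier_mat n k" and Q: "Q \<in> carrier_mat k k" and XVQ: "X = V * Q"
    and ev: "\<And>i. i < k \<Longrightarrow> A *\<^sub>v col V i = complex_of_real (eig_desc A ! (p + i)) \<cdot>\<^sub>v col V i"
    and p: "p + k \<le> n" and i: "i < k"
  shows "eig_desc (mat_adjoint X * A * X) ! i = eig_desc A ! (p + i)"
proof -
  let ?l = "map (\<lambda>i. eig_desc A ! (p + i)) [0..<k]"
  have "sorted (rev ?l)"
    using eig_desc_antimono[of _ _ A] length_eig_desc[OF A] p
    by (auto simp: sorted_iff_nth_mono rev_nth)
  then have "eig_desc (mat_adjoint X * A * X) = ?l"
    using mset_eig_desc_spanned[OF A X V Q XVQ ev] by (intro desc_list_unique) auto
  then show ?thesis using i by simp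
qed

text \<open>The bound is proved for every index set \<open>J\<close>, which makes it stable under
  index reversal and contains the sums of the \<open>j\<close> largest differences.\<close>

lemma ritz_bound_invariant:
  assumes A: "hermitian_mat A" "A \<in> carrier_mat n n"
    and X: "X \<in> carrier_mat n k" "mat_adjoint X * X = 1\<^sub>m k"
    and Y: "Y \<in> carrier_mat n k" "mat_adjoint Y * Y = 1\<^sub>m k"
    and inv: "invariant_cols A X" and extra: "extra_condition A X" and J: "J \<subseteq> {..<k}"
  shows "(\<Sum>i\<in>J. \<bar>eig_desc (mat_adjoint X * A * X) ! i - eig_desc (mat_adjoint Y * A * Y) ! i\<bar>)
    \<le> spr A * top_sin2 X Y (card J)"
proof (cases "k = 0")
  case True
  then show ?thesis using J by (simp add: top_sin2_def)
next
  case False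
  have kn: "k \<le> n" by (rule isometry_dim_le[OF X])
  define hi lo where "hi = eig_desc A ! 0" and "lo = eig_desc A ! (n - 1)"
  have spr: "spr A = hi - lo" using A by (simp add: spr_def hi_def lo_def)
  have bounds: "lo \<le> \<mu> \<and> \<mu> \<le> hi" if "\<mu> \<in> set (eig_desc A)" for \<mu>
  proof -
    obtain i where "i < n" "\<mu> = eig_desc A ! i" using \<open>\<mu> \<in> set (eig_desc A)\<close> A by (auto simp: in_set_conv_nth)
    then show ?thesis unfolding hi_def lo_def
      using eig_desc_antimono[of 0 i A] eig_desc_antimono[of i "n - 1" A] length_eig_desc[OF A(2)] by auto
  qed
  have "eig_desc A ! 0 \<in> set (eig_desc A)" using False kn length_eig_desc[OF A(2)] by (intro nth_mem) auto
  from bounds[OF this] have hilo: "lo \<le> hi" by simp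
  have q_lo: "lo * norm2 v \<le> qform A v" and q_hi: "qform A v \<le> hi * norm2 v" if "v \<in> carrier_vec n" for v
    using qform_ge_if_eigs_ge[OF A _ that] qform_le_if_eigs_le[OF A _ that] bounds by blast+
  let ?XA = "mat_adjoint X * A * X" and ?YA = "mat_adjoint Y * A * Y"
  have XA: "hermitian_mat ?XA" "?XA \<in> carrier_mat k k" and YA: "hermitian_mat ?YA" "?YA \<in> carrier_mat k k"
    using hermitian_congruence[OF A X(1)] congruence_carrier[OF A(2) X(1)]
      hermitian_congruence[OF A Y(1)] congruence_carrier[OF A(2) Y(1)] by blast+
  obtain M where M: "M \<in> carrier_mat k k" "A * X = X * M"
    using inv X(1) by (auto simp: invariant_cols_def)
  \<comment> \<open>The matrix witnessing invariance can only be the compression of \<open>A\<close>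
    by \<open>X\<close>.\<close>
  have "?XA = mat_adjoint X * (X * M)"
    using assoc_mult_mat[OF mat_adjoint_carrier[OF X(1)] A(2) X(1)] M(2) by metis
  also have "\<dots> = M"
    using assoc_mult_mat[OF mat_adjoint_carrier[OF X(1)] X(1) M(1)] X(2) M(1) by (metis left_mult_one_mat)
  finally have AX: "A * X = X * ?XA" using M(2) by metis
  have pair: "ritz_pair (affine_mat b a A) X Y n k" for a b
  proof
    have "X * (mat_adjoint X * affine_mat b a A * X) = X * affine_mat b a ?XA"
      unfolding congruence_affine_mat[OF A(2) X] ..
    then show "affine_mat b a A * X = X * (mat_adjoint X * affine_mat b a A * X)"
      unfolding mult_affine_mat[OF A(2) X(1)] affine_mat_mult[OF XA(2) X(1)] AX[symmetric] by simp
  qed (use A X Y hermitian_affine_mat in auto)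
  note congX = congruence_affine_mat[OF A(2) X] and congY = congruence_affine_mat[OF A(2) Y]
  note extremeI = ritz_pair.ritz_bound_extreme[OF pair, unfolded congX congY]
    and halfI = ritz_pair.ritz_bound_half[OF pair, unfolded congX congY]
  have shiftX: "eig_desc (affine_mat 1 a ?XA) ! i = eig_desc ?XA ! i + a"
    and shiftY: "eig_desc (affine_mat 1 a ?YA) ! i = eig_desc ?YA ! i + a"
    and reflX: "eig_desc (affine_mat (-1) a ?XA) ! i = a - eig_desc ?XA ! (k - 1 - i)"
    and reflY: "eig_desc (affine_mat (-1) a ?YA) ! i = a - eig_desc ?YA ! (k - 1 - i)"
    if "i < k" for i a
    using eig_desc_shift[OF XA that] eig_desc_shift[OF YA that]
      eig_desc_reflect[OF XA that] eig_desc_reflect[OF YA that] by blast+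
  have from_shift: ?thesis if "\<And>J. J \<subseteq> {..<k} \<Longrightarrow>
      (\<Sum>i\<in>J. \<bar>eig_desc (affine_mat 1 a ?XA) ! i - eig_desc (affine_mat 1 a ?YA) ! i\<bar>)
        \<le> (hi - lo) * top_sin2 X Y (card J)" for a
  proof -
    have "(\<Sum>i\<in>J. \<bar>eig_desc (affine_mat 1 a ?XA) ! i - eig_desc (affine_mat 1 a ?YA) ! i\<bar>)
      = (\<Sum>i\<in>J. \<bar>eig_desc ?XA ! i - eig_desc ?YA ! i\<bar>)"
      using J shiftX shiftY by (intro sum.cong) auto
    then show ?thesis using that[OF J] spr by simp
  qed
  have from_reflect: ?thesis if *: "\<And>J. J \<subseteq> {..<k} \<Longrightarrow>
      (\<Sum>i\<in>J. \<bar>eig_desc (affine_mat (-1) a ?XA) ! i - eig_desc (affine_mat (-1) a ?YA) ! i\<bar>)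
        \<le> (hi - lo) * top_sin2 X Y (card J)" for a
  proof (unfold spr, rule sum_abs_reflect[OF _ J, of a])
    fix I assume I: "I \<subseteq> {..<k}"
    have "(\<Sum>i\<in>I. \<bar>eig_desc (affine_mat (-1) a ?XA) ! i - eig_desc (affine_mat (-1) a ?YA) ! i\<bar>)
      = (\<Sum>i\<in>I. \<bar>(a - eig_desc ?XA ! (k - 1 - i)) - (a - eig_desc ?YA ! (k - 1 - i))\<bar>)"
      using I reflX reflY by (intro sum.cong) auto
    then show "(\<Sum>i\<in>I. \<bar>(a - eig_desc ?XA ! (k - 1 - i)) - (a - eig_desc ?YA ! (k - 1 - i))\<bar>)
      \<le> (hi - lo) * top_sin2 X Y (card I)"
      using *[OF I] by simp
  qed
  have half: "2 * ((hi - lo) / 2) = hi - lo" by simp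
  consider (top) "spanned_by_top_eigvecs A X" | (bottom) "spanned_by_bottom_eigvecs A X"
    | (near_top) "restr_eigs_near_top A X" | (near_bottom) "restr_eigs_near_bottom A X"
    using extra by (auto simp: extra_condition_def)
  then show ?thesis
  proof cases
    case top
    then obtain V Q where VQ: "V \<in> carrier_mat n k" "Q \<in> carrier_mat k k" "X = V * Q"
      "\<And>i. i < k \<Longrightarrow> A *\<^sub>v col V i = complex_of_real (eig_desc A ! (0 + i)) \<cdot>\<^sub>v col V i"
      using X(1) by (auto simp: spanned_by_top_eigvecs_def)
    have le: "eig_desc ?YA ! i \<le> eig_desc ?XA ! i" if "i < k" for i
      using cauchy_upper[OF A Y that] eig_desc_spanned[OF A(2) X VQ _ that] kn by simp
    show ?thesis
    \<comment> \<open>\<open>A - lo\<close> has its spectrum between \<open>0\<close> and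
      \<open>spr A\<close>, and interlacing fixes the sign of the differences.\<close>
    proof (rule from_shift[of "- lo"], rule extremeI)
      show "0 \<le> qform (affine_mat 1 (- lo) A) v" "qform (affine_mat 1 (- lo) A) v \<le> (hi - lo) * norm2 v"
        if "v \<in> carrier_vec n" for v
        using q_lo[OF that] q_hi[OF that] by (simp_all add: qform_affine_mat[OF A(2) that] algebra_simps)
    qed (use hilo le shiftX shiftY in auto)
  next
    case bottom
    then obtain V Q where VQ: "V \<in> carrier_mat n k" "Q \<in> carrier_mat k k" "X = V * Q"
      "\<And>i. i < k \<Longrightarrow> A *\<^sub>v col V i = complex_of_real (eig_desc A ! (n - k + i)) \<cdot>\<^sub>v col V i"
      using X(1) A(2) by (auto simp: spanned_by_bottom_eigvecs_def)
    have le: "eig_desc ?XA ! i \<le> eig_desc ?YA ! i" if "i < k" for i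
      using cauchy_lower[OF A Y that] eig_desc_spanned[OF A(2) X VQ _ that] kn by simp
    show ?thesis
    \<comment> \<open>\<open>hi - A\<close> also has its spectrum between \<open>0\<close> and
      \<open>spr A\<close>, and the bottom block of \<open>A\<close> becomes its top block.\<close>
    proof (rule from_reflect[of hi], rule extremeI)
      show "0 \<le> qform (affine_mat (-1) hi A) v" "qform (affine_mat (-1) hi A) v \<le> (hi - lo) * norm2 v"
        if "v \<in> carrier_vec n" for v
        using q_lo[OF that] q_hi[OF that] by (simp_all add: qform_affine_mat[OF A(2) that] algebra_simps)
    qed (use hilo le reflX reflY in auto)
  next
    case near_top
    \<comment> \<open>Subtracting the midpoint makes the restriction positive semidefinite and
      leaves a form bounded by half the spread; the factor 2 of \<open>halfI\<close> restores the
      full spread.\<close>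
    define c where "c = (hi + lo) / 2"
    have "c * norm2 v \<le> qform ?XA v" if "v \<in> carrier_vec k" for v
      using near_top A by (intro qform_ge_if_eigs_ge[OF XA _ that])
        (simp add: restr_eigs_near_top_def c_def hi_def lo_def)
    then have q: "0 \<le> qform (affine_mat 1 (- c) ?XA) v" if "v \<in> carrier_vec k" for v
      using that by (simp add: qform_affine_mat[OF XA(2) that])
    have qA: "\<bar>qform (affine_mat 1 (- c) A) v\<bar> \<le> (hi - lo) / 2 * norm2 v" if "v \<in> carrier_vec n" for v
      using q_lo[OF that] q_hi[OF that]
      by (simp add: qform_affine_mat[OF A(2) that] c_def abs_le_iff field_simps)
    show ?thesis
      by (rule from_shift[of "- c"], rule halfI[OF qA q, unfolded half]) (use hilo in auto)
  next
    case near_bottom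
    \<comment> \<open>The same with \<open>c - A\<close>, whose restriction is positive
      semidefinite.\<close>
    define c where "c = (hi + lo) / 2"
    have "qform ?XA v \<le> c * norm2 v" if "v \<in> carrier_vec k" for v
      using near_bottom A by (intro qform_le_if_eigs_le[OF XA _ that])
        (simp add: restr_eigs_near_bottom_def c_def hi_def lo_def)
    then have q: "0 \<le> qform (affine_mat (-1) c ?XA) v" if "v \<in> carrier_vec k" for v
      using that by (simp add: qform_affine_mat[OF XA(2) that])
    have qA: "\<bar>qform (affine_mat (-1) c A) v\<bar> \<le> (hi - lo) / 2 * norm2 v" if "v \<in> carrier_vec n" for v
      using q_lo[OF that] q_hi[OF that]
      by (simp add: qform_affine_mat[OF A(2) that] c_def abs_le_iff field_simps)
    show ?thesis
      by (rule from_reflect[of c], rule halfI[OF qA q, unfolded half]) (use hilo in auto)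
  qed
qed

section \<open>Weak submajorization\<close>

text \<open>Sorting is a permutation of positions; \<open>J\<close> collects the original positions
  of the first \<open>j\<close> entries.\<close>

lemma top_sum_as_subset_sum:
  fixes x :: "real list"
  assumes "j \<le> length x"
  obtains J where "J \<subseteq> {..<length x}" "card J = j" "sum_list (take j (rev (sort x))) = (\<Sum>i\<in>J. x ! i)"
proof -
  have "mset (rev (sort x)) = mset x" by simp
  then obtain p where p: "p permutes {..<length x}" "permute_list p x = rev (sort x)"
    using mset_eq_permutation by blast
  have inj: "inj_on p {..<j}" using p(1) by (meson inj_on_subset permutes_inj subset_UNIV)
  have "sum_list (take j (rev (sort x))) = (\<Sum>i<j. take j (rev (sort x)) ! i)"
    using assms by (simp add: sum_list_sum_nth atLeast0LessThan)
  also have "\<dots> = (\<Sum>i<j. x ! p i)"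
    using assms p(2)[symmetric] by (intro sum.cong) (auto simp: permute_list_nth[OF p(1)])
  also have "\<dots> = (\<Sum>i\<in>p ` {..<j}. x ! i)" by (simp add: sum.reindex[OF inj])
  finally have sum: "sum_list (take j (rev (sort x))) = (\<Sum>i\<in>p ` {..<j}. x ! i)" .
  have "p ` {..<j} \<subseteq> p ` {..<length x}" using assms by (intro image_mono) auto
  then have "p ` {..<j} \<subseteq> {..<length x}" by (simp only: permutes_image[OF p(1)])
  then show ?thesis by (rule that[OF _ _ sum]) (simp add: card_image[OF inj])
qed

section \<open>Principal angles\<close>

text \<open>Exchanging \<open>X\<close> and \<open>Y\<close> replaces \<open>?C\<close> by its
  adjoint, and the two Gram matrices have the same eigenvalues.\<close>

lemma top_sin2_commute:
  assumes "X \<in> carrier_mat n k" "Y \<in> carrier_mat n k"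
  shows "top_sin2 X Y = top_sin2 Y X"
proof -
  let ?C = "mat_adjoint X * Y"
  have C: "?C \<in> carrier_mat k k" using assms by auto
  have "mat_adjoint Y * X = mat_adjoint ?C"
    using mat_adjoint_mult[OF mat_adjoint_carrier[OF assms(1)] assms(2)] by simp
  then have "eig_desc (mat_adjoint (mat_adjoint Y * X) * (mat_adjoint Y * X)) = eig_desc (mat_adjoint ?C * ?C)"
    using eig_desc_mult_comm[OF C mat_adjoint_carrier[OF C]] by simp
  then show ?thesis using assms by (intro ext) (simp add: top_sin2_def)
qed

text \<open>On the unit interval the squared sine of \<open>arccos (sqrt x)\<close> is
  \<open>1 - x\<close>. The angles come in nonincreasing order, so the scaled list is already sorted
  and \<open>take j\<close> picks the last \<open>j\<close> squared cosines.\<close>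

lemma sum_take_sin2_princ_angles:
  assumes X: "X \<in> carrier_mat n k" "mat_adjoint X * X = 1\<^sub>m k"
    and Y: "Y \<in> carrier_mat n k" "mat_adjoint Y * Y = 1\<^sub>m k"
    and s: "k > 0 \<Longrightarrow> s \<ge> 0" and j: "j \<le> k"
  shows "sum_list (take j (rev (sort (map (\<lambda>t. s * (sin t)\<^sup>2) (princ_angles X Y))))) = s * top_sin2 X Y j"
proof -
  let ?C = "mat_adjoint X * Y"
  define c where "c = eig_desc (mat_adjoint ?C * ?C)"
  have "?C \<in> carrier_mat k k" using X Y by auto
  from length_eig_desc[OF gram_carrier[OF this]] have len: "length c = k" by (simp add: c_def)
  define y where "y = map (\<lambda>x. s * (1 - x)) (rev c)"
  have "(sin (arccos (sqrt x)))\<^sup>2 = 1 - x" if "x \<in> set c" for x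
  proof -
    have x: "0 \<le> x" "x \<le> 1" using cos2_bounds[OF X Y] that unfolding c_def by auto
    then have "sqrt x \<le> 1" "-1 \<le> sqrt x" using real_sqrt_ge_zero[OF x(1)] by (auto intro: order_trans[of _ 0])
    then show ?thesis using x by (simp add: sin_arccos)
  qed
  then have y: "map (\<lambda>t. s * (sin t)\<^sup>2) (princ_angles X Y) = y"
    unfolding y_def princ_angles_def sing_vals_def c_def[symmetric] by (simp add: rev_map)
  have "sorted (rev y)"
  proof (cases "k = 0")
    case False
    then have "s \<ge> 0" using s by simp
    then have "sorted_wrt (\<lambda>a b. s * (1 - a) \<le> s * (1 - b)) c"
      using sorted_rev_eig_desc[of "mat_adjoint ?C * ?C"] unfolding c_def[symmetric] sorted_wrt_rev
      by (elim sorted_wrt_mono_rel[rotated]) (auto intro: mult_left_mono)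
    then show ?thesis by (simp add: y_def rev_map sorted_map)
  qed (use len in \<open>simp add: y_def\<close>)
  then have "rev (sort y) = y" by (metis mset_rev properties_for_sort rev_rev_ident)
  then have "sum_list (take j (rev (sort y))) = (\<Sum>i<j. y ! i)"
    using j len by (simp add: sum_list_sum_nth atLeast0LessThan y_def)
  also have "\<dots> = (\<Sum>i<j. s * (1 - c ! (k - 1 - i)))"
    using j len by (intro sum.cong) (auto simp: y_def rev_nth)
  also have "\<dots> = (\<Sum>i\<in>{k - j..<k}. s * (1 - c ! i))"
    using j by (intro sum.reindex_bij_witness[of _ "\<lambda>i. k - 1 - i" "\<lambda>i. k - 1 - i"]) auto
  finally show ?thesis using y Y by (simp add: top_sin2_def c_def sum_distrib_left)
qed

theorem theorem3p2:
  fixes A X Y :: "complex mat" and n k :: nat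
  assumes "A \<in> carrier_mat n n" and "hermitian_mat A"
    and "X \<in> carrier_mat n k" and "Y \<in> carrier_mat n k"
    and "orthonormal_cols X" and "orthonormal_cols Y"
    and "(invariant_cols A X \<and> extra_condition A X) \<or> (invariant_cols A Y \<and> extra_condition A Y)"
  shows "weak_submaj
           (map2 (\<lambda>a b. \<bar>a - b\<bar>) (eig_desc (mat_adjoint X * A * X)) (eig_desc (mat_adjoint Y * A * Y)))
           (map (\<lambda>t. spr A * (sin t)\<^sup>2) (princ_angles X Y))"
proof -
  note A = assms(2,1)
  have X: "X \<in> carrier_mat n k" "mat_adjoint X * X = 1\<^sub>m k"
    and Y: "Y \<in> carrier_mat n k" "mat_adjoint Y * Y = 1\<^sub>m k"
    using assms by (auto simp: orthonormal_cols_def)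
  let ?a = "eig_desc (mat_adjoint X * A * X)" and ?b = "eig_desc (mat_adjoint Y * A * Y)"
  let ?x = "map2 (\<lambda>a b. \<bar>a - b\<bar>) ?a ?b" and ?y = "map (\<lambda>t. spr A * (sin t)\<^sup>2) (princ_angles X Y)"
  have la: "length ?a = k" and lb: "length ?b = k"
    using length_eig_desc[OF congruence_carrier[OF A(2) X(1)]] length_eig_desc[OF congruence_carrier[OF A(2) Y(1)]]
    by auto
  have "mat_adjoint X * Y \<in> carrier_mat k k" using X Y by auto
  from length_eig_desc[OF gram_carrier[OF this]] have ly: "length ?y = k"
    by (simp add: princ_angles_def sing_vals_def)
  \<comment> \<open>If \<open>Y\<close> spans the invariant subspace, the roles are exchanged; both
    sides are symmetric in \<open>X\<close> and \<open>Y\<close>.\<close>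
  have bound: "(\<Sum>i\<in>J. \<bar>?a ! i - ?b ! i\<bar>) \<le> spr A * top_sin2 X Y (card J)" if J: "J \<subseteq> {..<k}" for J
    using assms(7)
  proof
    assume "invariant_cols A X \<and> extra_condition A X"
    then show ?thesis using ritz_bound_invariant[OF A X Y _ _ J] by blast
  next
    assume "invariant_cols A Y \<and> extra_condition A Y"
    then have "(\<Sum>i\<in>J. \<bar>?b ! i - ?a ! i\<bar>) \<le> spr A * top_sin2 Y X (card J)"
      using ritz_bound_invariant[OF A Y X _ _ J] by blast
    then show ?thesis by (simp add: top_sin2_commute[OF X(1) Y(1)] abs_minus_commute)
  qed
  have "spr A \<ge> 0" if "k > 0"
    using eig_desc_antimono[of 0 "n - 1" A] that isometry_dim_le[OF X] length_eig_desc[OF A(2)] A(2)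
    by (simp add: spr_def)
  note sy = sum_take_sin2_princ_angles[OF X Y this]
  show ?thesis unfolding weak_submaj_def
  proof (intro conjI allI impI)
    show "length ?x = length ?y" using la lb ly by simp
    fix j assume "j \<le> length ?x"
    then have j: "j \<le> k" and "j \<le> length ?x" using la lb by auto
    \<comment> \<open>The \<open>j\<close> largest differences are differences over some index set
      of size \<open>j\<close>, to which \<open>bound\<close> applies.\<close>
    from \<open>j \<le> length ?x\<close> obtain J where J: "J \<subseteq> {..<length ?x}" "card J = j"
      "sum_list (take j (rev (sort ?x))) = (\<Sum>i\<in>J. ?x ! i)" by (rule top_sum_as_subset_sum)
    have Jk: "J \<subseteq> {..<k}" using J(1) la lb by simp
    have "(\<Sum>i\<in>J. ?x ! i) = (\<Sum>i\<in>J. \<bar>?a ! i - ?b ! i\<bar>)"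
      using Jk la lb by (intro sum.cong) auto
    then show "sum_list (take j (rev (sort ?x))) \<le> sum_list (take j (rev (sort ?y)))"
      using bound[OF Jk] J(2,3) sy[OF _ j] by simp
  qed
qed

end
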